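(* Let $0<\alpha<d$ and $1<p\leq q<\infty$ with $\frac{1}{q}+\frac{\alpha}{d}=\frac{1}{p}$, let $\mathcal{S}$ be a sparse collection of dyadic cubes in $\mathbb{R}^d$, and let $w$ be a weight. Then $$\|\mathcal{A}_{\alpha,2}^{\mathcal{S}}\|_{L^{p}(w^{p})\rightarrow L^{q,\infty}(w^{q})}\lesssim \begin{cases} [w]_{A_{p,q}}^{\frac{p'}{q}(1-\frac{\alpha}{d})}, & 2\leq q\leq\dfrac{2}{1-\frac{2\alpha}{d}},\\[2mm] [w]_{A_{p,q}}^{\frac{1}{2}-\frac{\alpha}{d}}, & \dfrac{2}{1-\frac{2\alpha}{d}}<q<\infty,\\[2mm] [w]_{A_{p,q}}^{\frac{1}{q}}, & 1\leq q<2. \end{cases}$$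
   Context: A weight on $\mathbb{R}^d$ is a locally integrable function $w:\mathbb{R}^d\to(0,\infty)$; $L^p(w^p)$ and $L^{q,\infty}(w^q)$ are taken with respect to the measures $w^p\,dx$ and $w^q\,dx$. Dyadic cubes are those of a fixed dyadic grid on $\mathbb{R}^d$. A collection $\mathcal{S}$ of dyadic cubes is sparse (with parameter $0<\gamma<1$) if for each $Q\in\mathcal{S}$ there is $E_Q\subset Q$ with $|E_Q|\geq\gamma|Q|$, the sets $E_Q$, $Q\in\mathcal S$, being pairwise disjoint. For nonnegative $f$ set $$\langle f\rangle_{\alpha,Q}=\frac{1}{|Q|^{1-\alpha/d}}\int_Q f,\qquad \mathcal{A}_{\alpha,2}^{\mathcal{S}}(f)=\Big(\sum_{Q\in\mathcal{S}}\langle f\rangle_{\alpha,Q}^{2}\mathbf{1}_Q\Big)^{1/2}.$$ The norm $\|\mathcal{A}_{\alpha,2}^{\mathcal{S}}\|_{L^{p}(w^{p})\rightarrow L^{q,\infty}(w^{q})}$ is the least $C\in[0,\infty]$ with $\|\mathcal{A}_{\alpha,2}^{\mathcal{S}}(f)\|_{L^{q,\infty}(w^q)}\le C\|f\|_{L^p(w^p)}$ for all nonnegative $f\in L^p(w^p)$. With $1/p+1/p'=1$, $$[w]_{A_{p,q}}=\sup_Q\Big(\frac{1}{|Q|}\int_Q w^q\Big)\Big(\frac{1}{|Q|}\int_Q w^{-p'}\Big)^{q/p'},$$ the supremum being over dyadic cubes. The notation $\lesssim$ means inequality up to a constant depending only on $p,q,\alpha,d$ and the sparsity parameter $\gamm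a$.
   Formalization: For 2α ≥ d, where 2/(1−2α/d) is undefined or negative and the second bound would be false, the threshold is read as +∞: the first bound is then claimed for all q ≥ 2 and the third for q < 2. *)

theory Defs
  imports "HOL-Analysis.Analysis"
begin

text \<open>
  The space is \<open>real ^ 'd\<close>, of dimension \<open>CARD('d)\<close>. All integrals are Lebesgue integrals of
  extended nonnegative functions, so that averages, norms and weight constants may be infinite.
\<close>

text \<open>Real powers in \<open>[0, \<infinity>]\<close>; only used below with exponents \<open>a > 0\<close>, for which \<open>\<infinity>\<^sup>a = \<infinity>\<close> and
  \<open>0\<^sup>a = 0\<close>.\<close>

definition epowr :: "ennreal \<Rightarrow> real \<Rightarrow> ennreal" where
  "epowr x a = (if x = \<infinity> then \<infinity> else ennreal (enn2real x powr a))"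

definition cube :: "real ^ 'd \<Rightarrow> real \<Rightarrow> (real ^ 'd) set" where
  "cube a l = {x. \<forall>i. a $ i \<le> x $ i \<and> x $ i < a $ i + l}"

text \<open>A general dyadic grid: half-open cubes of side lengths \<open>2\<^sup>k\<close>, \<open>k \<in> \<int>\<close>, any two of them nested or
  disjoint, those of each fixed side length partitioning the space.\<close>

definition dyadic_grid :: "(real ^ 'd) set set \<Rightarrow> bool" where
  "dyadic_grid D \<longleftrightarrow>
     (\<forall>Q\<in>D. \<exists>a. \<exists>k::int. Q = cube a (2 powi k)) \<and>
     (\<forall>Q\<in>D. \<forall>R\<in>D. Q \<subseteq> R \<or> R \<subseteq> Q \<or> Q \<inter> R = {}) \<and>
     (\<forall>k::int. partition_on UNIV {Q \<in> D. \<exists>a. Q = cube a (2 powi k)})"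

definition sparse_collection :: "real \<Rightarrow> (real ^ 'd) set set \<Rightarrow> bool" where
  "sparse_collection \<gamma> S \<longleftrightarrow>
     (\<exists>E :: (real ^ 'd) set \<Rightarrow> (real ^ 'd) set.
        (\<forall>Q\<in>S. E Q \<in> sets lebesgue \<and> E Q \<subseteq> Q \<and> measure lebesgue (E Q) \<ge> \<gamma> * measure lebesgue Q) \<and>
        disjoint_family_on E S)"

definition weight :: "(real ^ 'd \<Rightarrow> real) \<Rightarrow> bool" where
  "weight w \<longleftrightarrow> w \<in> borel_measurable lebesgue \<and> (\<forall>x. 0 < w x) \<and>
     (\<forall>K. compact K \<longrightarrow> set_integrable lebesgue K w)"

text \<open>The measure \<open>w\<^sup>r dx\<close>.\<close>

definition pow_measure :: "(real ^ 'd \<Rightarrow> real) \<Rightarrow> real \<Rightarrow> (real ^ 'd) measure" where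
  "pow_measure w r = density lebesgue (\<lambda>x. ennreal (w x powr r))"

definition Lp_norm :: "'a measure \<Rightarrow> real \<Rightarrow> ('a \<Rightarrow> real) \<Rightarrow> ennreal" where
  "Lp_norm M p f = epowr (\<integral>\<^sup>+x. ennreal (\<bar>f x\<bar> powr p) \<partial>M) (1 / p)"

definition weak_Lq_norm :: "'a measure \<Rightarrow> real \<Rightarrow> ('a \<Rightarrow> ennreal) \<Rightarrow> ennreal" where
  "weak_Lq_norm M q g =
     (SUP t\<in>{0<..}. ennreal t * epowr (emeasure M {x \<in> space M. ennreal t < g x}) (1 / q))"

definition frac_avg :: "real \<Rightarrow> (real ^ 'd) set \<Rightarrow> (real ^ 'd \<Rightarrow> real) \<Rightarrow> ennreal" where
  "frac_avg \<alpha> Q f =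
     (\<integral>\<^sup>+x\<in>Q. ennreal (f x) \<partial>lebesgue) / ennreal (measure lebesgue Q powr (1 - \<alpha> / real CARD('d)))"

definition sparse_op :: "real \<Rightarrow> (real ^ 'd) set set \<Rightarrow> (real ^ 'd \<Rightarrow> real) \<Rightarrow> real ^ 'd \<Rightarrow> ennreal" where
  "sparse_op \<alpha> S f x = epowr (\<Sum>\<^sub>\<infinity>Q\<in>S. (frac_avg \<alpha> Q f)\<^sup>2 * indicator Q x) (1 / 2)"

definition sparse_op_norm ::
    "real \<Rightarrow> (real ^ 'd) set set \<Rightarrow> (real ^ 'd \<Rightarrow> real) \<Rightarrow> real \<Rightarrow> real \<Rightarrow> ennreal" where
  "sparse_op_norm \<alpha> S w p q =
     Inf {C. \<forall>f. f \<in> borel_measurable lebesgue \<longrightarrow> (\<forall>x. 0 \<le> f x) \<longrightarrow>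
                 Lp_norm (pow_measure w p) p f < \<infinity> \<longrightarrow>
                 weak_Lq_norm (pow_measure w q) q (sparse_op \<alpha> S f)
                   \<le> C * Lp_norm (pow_measure w p) p f}"

definition conj_exp :: "real \<Rightarrow> real" where
  "conj_exp p = p / (p - 1)"

definition Apq_const :: "(real ^ 'd) set set \<Rightarrow> real \<Rightarrow> real \<Rightarrow> (real ^ 'd \<Rightarrow> real) \<Rightarrow> ennreal" where
  "Apq_const D p q w =
     (SUP Q\<in>D. ((\<integral>\<^sup>+x\<in>Q. ennreal (w x powr q) \<partial>lebesgue) / emeasure lebesgue Q) *
        epowr ((\<integral>\<^sup>+x\<in>Q. ennreal (w x powr (- conj_exp p)) \<partial>lebesgue) / emeasure lebesgue Q)
          (q / conj_exp p))"

text \<open>The endpoint \<open>2 / (1 - 2\<alpha>/d)\<close> of the range of \<open>q\<close>. For \<open>2\<alpha> \<ge> d\<close> it is \<open>\<infinity>\<close>: the condition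
  \<open>q \<le> 2 / (1 - 2\<alpha>/d)\<close> stands for \<open>1/2 - \<alpha>/d \<le> 1/q\<close>, which then always holds.\<close>

definition q_threshold :: "real \<Rightarrow> nat \<Rightarrow> ereal" where
  "q_threshold \<alpha> d =
     (if 2 * \<alpha> < real d then ereal (2 / (1 - 2 * \<alpha> / real d)) else \<infinity>)"

end

theory Submission
  imports Defs
begin

text \<open>
  Write \<open>\<omega> = w\<^sup>q\<close>, \<open>A\<close> for the weight constant, \<open>r = q/p > 1\<close>, and \<open>F(E)\<close> for the integral of
  \<open>f\<^sup>p w\<^sup>p\<close> over \<open>E\<close>. Split a finite sparse family into bands on which the fractional averages of \<open>f\<close>
  are comparable to a level \<open>\<tau>\<close>, and let \<open>N\<close> be the overlap count of a band. The theorem rests on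

  \<open>\<omega>{N \<ge> n} \<le> C A \<tau>\<^sup>-\<^sup>q F\<^sup>r n\<^sup>-\<^sup>r (A/n)\<^sup>\<beta>\<close>  for every \<open>\<beta> \<ge> 0\<close>.

  The factor \<open>n\<^sup>-\<^sup>r\<close> comes from \<open>\<alpha> > 0\<close>: the integral of \<open>f\<close> over a cube \<open>Q\<close> of the band is comparable to
  \<open>\<tau> |Q|\<^sup>1\<^sup>-\<^sup>\<alpha>\<^sup>/\<^sup>d\<close>, so a distant descendant \<open>P\<close> holds at most half of it, and Hoelder's
  inequality on \<open>Q - P\<close> gives \<open>\<omega>(Q) \<le> C A \<tau>\<^sup>-\<^sup>q F(Q - P)\<^sup>r\<close>; induct over the generations. The
  factor \<open>(A/n)\<^sup>\<beta>\<close> comes from sparseness: boundedly many generations lose half of their Lebesgue measure,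
  hence, by the weight condition, at least the fraction \<open>c/A\<close> of their \<open>\<omega>\<close>-measure.

  If the square function exceeds \<open>t\<close>, then on some band of level about \<open>2\<^sup>-\<^sup>j t s\<close> the count exceeds
  \<open>c 2\<^sup>-\<^sup>\<epsilon>\<^sup>|\<^sup>j\<^sup>| 4\<^sup>j / s\<^sup>2\<close>, and summing the bound over the integers \<open>j\<close> gives the weak type estimate. For \<open>p \<le> 2\<close>
  take \<open>s = 1\<close>, with \<open>\<beta> = 0\<close> if \<open>q < 2\<close> and \<open>\<beta> = p'/q\<close> if \<open>q \<ge> 2\<close>; for \<open>p > 2\<close>, which is the range
  \<open>q > 2/(1 - 2\<alpha>/d)\<close>, take \<open>s = A\<^sup>-\<^sup>1\<^sup>/\<^sup>2\<close>.
\<close>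

section \<open>Inequalities\<close>

text \<open>Weighted AM-GM for the numbers \<open>1 - s * x\<close> and \<open>1\<close> with
  weights \<open>1 / s\<close> and \<open>1 - 1 / s\<close>, then raised to the power
  \<open>s\<close>.\<close>

lemma Bernoulli_inequality_powr:
  fixes x s :: real
  assumes "0 \<le> x" "1 \<le> s" "s * x < 1"
  shows "1 - s * x \<le> (1 - x) powr s"
proof -
  have "(1 - s * x) powr (1 / s) * 1 powr (1 - 1 / s) \<le> 1 / s * (1 - s * x) + (1 - 1 / s) * 1"
    using assms by (intro Youngs_inequality_0) auto
  also have "\<dots> = 1 - x"
    using assms by (simp add: field_simps)
  finally have "(1 - s * x) powr (1 / s) \<le> 1 - x"
    by simp
  then have "((1 - s * x) powr (1 / s)) powr s \<le> (1 - x) powr s"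
    using assms by (intro powr_mono2) auto
  then show ?thesis
    using assms by (simp add: powr_powr)
qed

text \<open>Geometric decay is traded for a power of any order, because the final bounds are powers
  of the weight constant. For \<beta> > 0, raise \<open>x / \<beta> \<le> exp (x / \<beta>)\<close>
  to the power \<beta>.\<close>

lemma exp_minus_le_powr:
  fixes \<beta> :: real
  assumes "0 \<le> \<beta>"
  shows "\<exists>C>0. \<forall>x>0. exp (- x) \<le> C * x powr - \<beta>"
proof (cases "\<beta> = 0")
  case True
  then show ?thesis by (intro exI[of _ 1]) auto
next
  case False
  then have b: "0 < \<beta>" using assms by simp
  have "exp (- x) \<le> \<beta> powr \<beta> * x powr - \<beta>" if "0 < x" for x
  proof -
    have "x / \<beta> \<le> exp (x / \<beta>)"
      using exp_ge_add_one_self[of "x / \<beta>"] by linarith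
    then have "(x / \<beta>) powr \<beta> \<le> exp (x / \<beta>) powr \<beta>"
      using b that by (intro powr_mono2) auto
    also have "\<dots> = exp x"
      using b by (simp add: powr_def)
    finally have "x powr \<beta> \<le> \<beta> powr \<beta> * exp x"
      using b that by (simp add: powr_divide field_simps)
    then show ?thesis
      using b that by (simp add: powr_minus exp_minus field_simps)
  qed
  then show ?thesis
    using b by (intro exI[of _ "\<beta> powr \<beta>"]) auto
qed

text \<open>Two geometric series, one for each sign of \<open>j\<close>. The bound is independent of
  \<open>J\<close>, so the number of occupied levels never enters the estimates.\<close>

lemma sum_powr_abs_int_le:
  fixes \<delta> :: real and J :: "int set"
  assumes "0 < \<delta>" "finite J"
  shows "(\<Sum>j\<in>J. 2 powr - (\<delta> * \<bar>real_of_int j\<bar>)) \<le> 2 / (1 - 2 powr - \<delta>)"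
proof -
  define x :: real where "x = 2 powr - \<delta>"
  have x: "0 < x" "x < 1"
    using assms powr_less_cancel_iff[of 2 "- \<delta>" 0] by (auto simp: x_def)
  have pw: "2 powr - (\<delta> * real n) = x ^ n" for n
    unfolding x_def by (simp add: powr_powr flip: powr_realpow)
  have half: "(\<Sum>j\<in>J'. 2 powr - (\<delta> * \<bar>real_of_int j\<bar>)) \<le> 1 / (1 - x)"
    if J': "finite J'" "inj_on (\<lambda>j. nat \<bar>j\<bar>) J'" for J'
  proof -
    have "(\<Sum>j\<in>J'. 2 powr - (\<delta> * \<bar>real_of_int j\<bar>)) = (\<Sum>j\<in>J'. x ^ nat \<bar>j\<bar>)"
      by (intro sum.cong refl) (simp flip: pw)
    also have "\<dots> = (\<Sum>n\<in>(\<lambda>j. nat \<bar>j\<bar>) ` J'. x ^ n)"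
      using J' by (simp add: sum.reindex)
    also have "\<dots> \<le> (\<Sum>n. x ^ n)"
      using x J' by (intro sum_le_suminf summable_geometric) auto
    also have "\<dots> = 1 / (1 - x)"
      using x by (intro suminf_geometric) auto
    finally show ?thesis .
  qed
  have "(\<Sum>j\<in>J. 2 powr - (\<delta> * \<bar>real_of_int j\<bar>)) =
      (\<Sum>j\<in>(J \<inter> {0..}) \<union> (J \<inter> {..<0}). 2 powr - (\<delta> * \<bar>real_of_int j\<bar>))"
    by (intro sum.cong) auto
  also have "\<dots> = (\<Sum>j\<in>J \<inter> {0..}. 2 powr - (\<delta> * \<bar>real_of_int j\<bar>)) +
      (\<Sum>j\<in>J \<inter> {..<0}. 2 powr - (\<delta> * \<bar>real_of_int j\<bar>))"
    using assms by (intro sum.union_disjoint) auto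
  also have "\<dots> \<le> 1 / (1 - x) + 1 / (1 - x)"
    using assms by (intro add_mono half) (auto simp: inj_on_def)
  finally show ?thesis by (simp add: x_def)
qed

text \<open>One factor of each power is kept for the sum, the remaining exponent
  \<open>r - 1\<close> goes to the uniform bound. When \<open>b\<close> is smaller than
  \<open>G\<close>, this is where \<open>r > 1\<close> yields a gain.\<close>

lemma sum_powr_le_powr_mult:
  fixes g :: "'i \<Rightarrow> real"
  assumes "\<And>i. i \<in> I \<Longrightarrow> 0 \<le> g i" "\<And>i. i \<in> I \<Longrightarrow> g i \<le> b" "(\<Sum>i\<in>I. g i) \<le> G" "1 \<le> r"
  shows "(\<Sum>i\<in>I. g i powr r) \<le> b powr (r - 1) * G"
proof -
  have "(\<Sum>i\<in>I. g i powr r) \<le> (\<Sum>i\<in>I. b powr (r - 1) * g i)"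
  proof (rule sum_mono)
    fix i assume i: "i \<in> I"
    have "g i powr r = g i powr (r - 1) * g i"
      using assms(1)[OF i] powr_add[of "g i" "r - 1" 1] by (cases "g i = 0") auto
    also have "\<dots> \<le> b powr (r - 1) * g i"
      using assms(1,2)[OF i] assms(4) by (intro mult_right_mono powr_mono2) auto
    finally show "g i powr r \<le> b powr (r - 1) * g i" .
  qed
  also have "\<dots> \<le> b powr (r - 1) * G"
    unfolding sum_distrib_left[symmetric] using assms by (intro mult_left_mono) auto
  finally show ?thesis .
qed

text \<open>Young's inequality for \<open>u / U powr (1 / a)\<close> and
  \<open>v / V powr (1 / b)\<close>, integrated. If \<open>U\<close> or \<open>V\<close> vanishes,
  this normalisation is impossible, but then the product is zero almost everywhere.\<close>

lemma nn_integral_Holder: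
  fixes u v :: "'a \<Rightarrow> real" and a b U V :: real
  assumes [measurable]: "u \<in> borel_measurable M" "v \<in> borel_measurable M"
    and nn: "\<And>x. 0 \<le> u x" "\<And>x. 0 \<le> v x"
    and ab: "0 < a" "0 < b" "1 / a + 1 / b = 1"
    and UV: "0 \<le> U" "0 \<le> V"
    and U: "(\<integral>\<^sup>+x. ennreal (u x powr a) \<partial>M) = ennreal U"
    and V: "(\<integral>\<^sup>+x. ennreal (v x powr b) \<partial>M) = ennreal V"
  shows "(\<integral>\<^sup>+x. ennreal (u x * v x) \<partial>M) \<le> ennreal (U powr (1 / a) * V powr (1 / b))"
proof (cases "U = 0 \<or> V = 0")
  case True
  then have "(AE x in M. ennreal (u x powr a) = 0) \<or> (AE x in M. ennreal (v x powr b) = 0)"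
    using U V by (subst (1 2) nn_integral_0_iff_AE[symmetric]) auto
  then have "AE x in M. ennreal (u x * v x) = 0"
  proof
    assume "AE x in M. ennreal (u x powr a) = 0"
    then show ?thesis
      by eventually_elim (use nn in \<open>auto simp: ennreal_eq_0_iff\<close>)
  next
    assume "AE x in M. ennreal (v x powr b) = 0"
    then show ?thesis
      by eventually_elim (use nn in \<open>auto simp: ennreal_eq_0_iff\<close>)
  qed
  then have "(\<integral>\<^sup>+x. ennreal (u x * v x) \<partial>M) = 0"
    by (subst nn_integral_0_iff_AE) auto
  then show ?thesis by simp
next
  case False
  then have UV: "0 < U" "0 < V" using UV by auto
  define c where "c = U powr (1 / a) * V powr (1 / b)"
  have pt: "u x * v x \<le> c / (a * U) * u x powr a + c / (b * V) * v x powr b" for x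
  proof -
    have "0 < 1 / a" "0 < 1 / b"
      using ab by auto
    then have "1 / a < 1" "1 / b < 1"
      using ab(3) by linarith+
    then have "a > 1" "b > 1"
      using ab by (simp_all add: divide_less_eq)
    then have "u x / U powr (1 / a) * (v x / V powr (1 / b))
        \<le> (u x / U powr (1 / a)) powr a / a + (v x / V powr (1 / b)) powr b / b"
      using ab UV nn by (intro Youngs_inequality) auto
    also have "u x / U powr (1 / a) * (v x / V powr (1 / b)) = u x * v x / c"
      by (simp add: c_def)
    also have "(u x / U powr (1 / a)) powr a / a + (v x / V powr (1 / b)) powr b / b
        = 1 / a * (u x powr a / U) + 1 / b * (v x powr b / V)"
      using ab UV nn[of x] by (simp add: powr_divide powr_powr mult.commute)
    finally have "c * (u x * v x / c) \<le> c * (1 / a * (u x powr a / U) + 1 / b * (v x powr b / V))"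
      using UV by (intro mult_left_mono) (auto simp: c_def)
    then show ?thesis using UV by (simp add: c_def algebra_simps)
  qed
  have "(\<integral>\<^sup>+x. ennreal (u x * v x) \<partial>M)
      \<le> (\<integral>\<^sup>+x. ennreal (c / (a * U)) * ennreal (u x powr a) + ennreal (c / (b * V)) * ennreal (v x powr b) \<partial>M)"
    using ab UV pt by (intro nn_integral_mono)
      (auto simp: c_def ennreal_leI simp flip: ennreal_mult' ennreal_plus)
  also have "\<dots> = ennreal (c / (a * U)) * ennreal U + ennreal (c / (b * V)) * ennreal V"
    by (simp add: nn_integral_add nn_integral_cmult U V)
  also have "\<dots> = ennreal (c / a + c / b)"
    using ab(1,2) UV by (simp add: c_def flip: ennreal_mult' ennreal_plus)
  also have "c / a + c / b = c * (1 / a + 1 / b)"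
    by (simp add: algebra_simps)
  also have "\<dots> = c"
    by (simp only: ab(3) mult_1_right)
  finally show ?thesis by (simp add: c_def)
qed

text \<open>The inequality is strict because \<alpha> > 0. It supplies the exponent r > 1 on which
  the polynomial decay in the overlap count rests.\<close>

lemma one_less_exponent_quotient:
  fixes \<alpha> p q n :: real
  assumes "0 < \<alpha>" "0 < n" "0 < p" "0 < q" "1 / q + \<alpha> / n = 1 / p"
  shows "1 < q / p"
proof -
  have "0 < \<alpha> / n" using assms by simp
  then have "1 / q < 1 / p" using assms by linarith
  then show ?thesis using assms by (simp add: field_simps)
qed

section \<open>Laminar families\<close>

definition laminar :: "'a set set \<Rightarrow> bool" where
  "laminar S \<longleftrightarrow> finite S \<and> {} \<notin> S \<and> (\<forall>Q\<in>S. \<forall>R\<in>S. Q \<subseteq> R \<or> R \<subseteq> Q \<or> Q \<inter> R = {})"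

definition overlap :: "'a set set \<Rightarrow> 'a \<Rightarrow> nat" where
  "overlap S x = card {Q \<in> S. x \<in> Q}"

text \<open>Generations are counted from 1: a member contains itself, so the maximal members have
  depth 1.\<close>

definition depth :: "'a set set \<Rightarrow> 'a set \<Rightarrow> nat" where
  "depth S Q = card {P \<in> S. Q \<subseteq> P}"

definition level :: "'a set set \<Rightarrow> nat \<Rightarrow> 'a set set" where
  "level S n = {Q \<in> S. depth S Q = n}"

text \<open>\<open>deep S 0\<close> is the whole type; hence the assumptions \<open>0 < n\<close> in
  the measure estimates.\<close>

definition deep :: "'a set set \<Rightarrow> nat \<Rightarrow> 'a set" where
  "deep S n = {x. n \<le> overlap S x}"

context
  fixes S :: "'a set set"
  assumes S: "laminar S"
begin

lemma finite_laminar: "finite S"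
  using S by (simp add: laminar_def)

lemma laminar_cases: "Q \<in> S \<Longrightarrow> R \<in> S \<Longrightarrow> Q \<subseteq> R \<or> R \<subseteq> Q \<or> Q \<inter> R = {}"
  using S by (simp add: laminar_def)

lemma depth_pos: "Q \<in> S \<Longrightarrow> 0 < depth S Q"
  using finite_laminar by (auto simp: depth_def card_gt_0_iff)

lemma depth_le_overlap: "x \<in> Q \<Longrightarrow> depth S Q \<le> overlap S x"
  using finite_laminar by (auto simp: depth_def overlap_def intro!: card_mono)

lemma depth_strict_mono: "Q \<in> S \<Longrightarrow> R \<in> S \<Longrightarrow> R \<subset> Q \<Longrightarrow> depth S Q < depth S R"
  using finite_laminar unfolding depth_def by (intro psubset_card_mono) auto

text \<open>Members with a common point form a chain, and depth strictly increases down the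
  chain.\<close>

lemma subset_of_depth_le:
  assumes "Q \<in> S" "R \<in> S" "x \<in> Q" "x \<in> R" "depth S Q \<le> depth S R"
  shows "R \<subseteq> Q"
  using laminar_cases[of Q R] depth_strict_mono[of R Q] assms by fastforce

lemma disjnt_of_depth_eq:
  assumes "Q \<in> S" "R \<in> S" "depth S Q = depth S R" "Q \<noteq> R"
  shows "disjnt Q R"
proof (rule ccontr)
  assume "\<not> disjnt Q R"
  then obtain x where "x \<in> Q" "x \<in> R" by (auto simp: disjnt_iff)
  then show False
    using subset_of_depth_le[of Q R x] subset_of_depth_le[of R Q x] assms by auto
qed

lemma pairwise_disjnt_level: "pairwise disjnt (level S n)"
  unfolding pairwise_def level_def using disjnt_of_depth_eq by auto

lemma finite_level: "finite (level S n)"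
  using finite_laminar by (simp add: level_def)

lemma level_subset: "level S n \<subseteq> S"
  by (auto simp: level_def)

text \<open>The members containing \<open>x\<close> have distinct depths between 1 and
  \<open>overlap S x\<close>, and there are exactly \<open>overlap S x\<close> of them, so every
  depth in this range occurs.\<close>

lemma exists_depth_eq:
  assumes "0 < n" "n \<le> overlap S x"
  shows "\<exists>Q\<in>S. x \<in> Q \<and> depth S Q = n"
proof -
  let ?C = "{Q \<in> S. x \<in> Q}"
  have "inj_on (depth S) ?C"
    using disjnt_of_depth_eq by (auto simp: inj_on_def disjnt_iff)
  then have "card (depth S ` ?C) = overlap S x"
    by (simp add: card_image overlap_def)
  moreover have "depth S ` ?C \<subseteq> {1..overlap S x}"
    using depth_pos depth_le_overlap by (auto simp: Suc_le_eq)
  ultimately have "depth S ` ?C = {1..overlap S x}"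
    by (intro card_subset_eq) auto
  then have "n \<in> depth S ` ?C"
    using assms by auto
  then show ?thesis by auto
qed

lemma deep_eq_Union_level: "0 < n \<Longrightarrow> deep S n = \<Union> (level S n)"
proof (intro equalityI subsetI)
  fix x assume "0 < n" "x \<in> deep S n"
  then show "x \<in> \<Union> (level S n)"
    using exists_depth_eq[of n x] by (auto simp: deep_def level_def)
next
  fix x assume "x \<in> \<Union> (level S n)"
  then obtain Q where "x \<in> Q" "depth S Q = n" by (auto simp: level_def)
  then show "x \<in> deep S n"
    using depth_le_overlap[of x Q] by (simp add: deep_def)
qed

lemma Int_deep_subset:
  assumes "Q \<in> S" "depth S Q \<le> n"
  shows "Q \<inter> deep S n \<subseteq> \<Union> {P \<in> level S n. P \<subseteq> Q}"
proof
  fix x assume x: "x \<in> Q \<inter> deep S n"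
  then obtain P where "P \<in> S" "x \<in> P" "depth S P = n"
    using exists_depth_eq[of n x] depth_pos[of Q] assms by (auto simp: deep_def)
  then show "x \<in> \<Union> {P \<in> level S n. P \<subseteq> Q}"
    using subset_of_depth_le[of Q P x] assms x by (auto simp: level_def)
qed

lemma deep_antimono: "m \<le> n \<Longrightarrow> deep S n \<subseteq> deep S m"
  by (auto simp: deep_def)

section \<open>Measure decay on the deep sets of a laminar family\<close>

context
  fixes M :: "'a measure"
  assumes meas: "S \<subseteq> fmeasurable M"
begin

lemma fmeasurable_deep: "0 < n \<Longrightarrow> deep S n \<in> fmeasurable M"
  using finite_level[of n] level_subset[of n] meas deep_eq_Union_level[of n]
  by (auto intro!: fmeasurable.finite_Union)

lemma fmeasurable_level: "P \<in> level S i \<Longrightarrow> P \<in> fmeasurable M"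
  using level_subset meas by blast

lemma fmeasurable_Int_deep: "P \<in> fmeasurable M \<Longrightarrow> 0 < n \<Longrightarrow> P \<inter> deep S n \<in> fmeasurable M"
  using fmeasurable_deep by (intro fmeasurable.Int) auto

lemma measure_Int_deep_le:
  assumes "Q \<in> S" "depth S Q \<le> i" "i \<le> n"
  shows "measure M (Q \<inter> deep S n) \<le> (\<Sum>P\<in>{P \<in> level S i. P \<subseteq> Q}. measure M (P \<inter> deep S n))"
proof -
  have n: "0 < n" using depth_pos assms by fastforce
  have "Q \<inter> deep S n \<subseteq> (\<Union>P\<in>{P \<in> level S i. P \<subseteq> Q}. P \<inter> deep S n)"
    using Int_deep_subset[OF assms(1,2)] deep_antimono[OF assms(3)] by blast
  moreover have "(\<Union>P\<in>{P \<in> level S i. P \<subseteq> Q}. P \<inter> deep S n) \<in> fmeasurable M"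
    using finite_level n by (intro fmeasurable.finite_UN) (auto intro: fmeasurable_Int_deep fmeasurable_level)
  ultimately have "measure M (Q \<inter> deep S n)
      \<le> measure M (\<Union>P\<in>{P \<in> level S i. P \<subseteq> Q}. P \<inter> deep S n)"
    using meas assms fmeasurable_deep[OF n] by (intro measure_mono_fmeasurable) auto
  also have "\<dots> \<le> (\<Sum>P\<in>{P \<in> level S i. P \<subseteq> Q}. measure M (P \<inter> deep S n))"
    using finite_level n
    by (intro measure_UNION_le) (auto intro!: fmeasurableD[OF fmeasurable_Int_deep] fmeasurable_level)
  finally show ?thesis .
qed

lemma measure_deep_le:
  assumes "0 < i" "i \<le> n"
  shows "measure M (deep S n) \<le> (\<Sum>P\<in>level S i. measure M (P \<inter> deep S n))"
proof -
  have "deep S n = (\<Union>P\<in>level S i. P \<inter> deep S n)"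
    using deep_antimono[OF assms(2)] deep_eq_Union_level[OF assms(1)] by auto
  then have "measure M (deep S n) = measure M (\<Union>P\<in>level S i. P \<inter> deep S n)" by simp
  also have "\<dots> \<le> (\<Sum>P\<in>level S i. measure M (P \<inter> deep S n))"
    using finite_level assms
    by (intro measure_UNION_le) (auto intro!: fmeasurableD[OF fmeasurable_Int_deep] fmeasurable_level)
  finally show ?thesis .
qed

lemma sum_measure_level:
  assumes "I \<subseteq> level S n"
  shows "(\<Sum>P\<in>I. measure M P) = measure M (\<Union>I)"
  using finite_subset[OF assms finite_level] assms level_subset[of n] meas pairwise_subset[OF pairwise_disjnt_level assms]
  by (intro measure_Union'[symmetric]) auto

text \<open>A deep set is the disjoint union of the members of one depth, so the loss assumed below
  a single member holds for all of them at once and can be iterated.\<close>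

lemma measure_deep_geometric:
  assumes "0 \<le> \<rho>" "0 < i"
    and step: "\<And>Q. Q \<in> S \<Longrightarrow> measure M (Q \<inter> deep S (depth S Q + n\<^sub>0)) \<le> \<rho> * measure M Q"
  shows "measure M (deep S (i + j * n\<^sub>0)) \<le> \<rho> ^ j * measure M (deep S i)"
proof (induction j)
  case (Suc j)
  let ?k = "i + j * n\<^sub>0"
  have "measure M (deep S (?k + n\<^sub>0)) \<le> (\<Sum>P\<in>level S ?k. measure M (P \<inter> deep S (?k + n\<^sub>0)))"
    using assms by (intro measure_deep_le) auto
  also have "\<dots> \<le> (\<Sum>P\<in>level S ?k. \<rho> * measure M P)"
  proof (rule sum_mono)
    fix P assume "P \<in> level S ?k"
    then show "measure M (P \<inter> deep S (?k + n\<^sub>0)) \<le> \<rho> * measure M P"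
      using step[of P] by (simp add: level_def)
  qed
  also have "\<dots> = \<rho> * measure M (deep S ?k)"
    using assms sum_measure_level[of "level S ?k" ?k] deep_eq_Union_level[of ?k]
    by (simp flip: sum_distrib_left)
  also have "\<dots> \<le> \<rho> * (\<rho> ^ j * measure M (deep S i))"
    using assms Suc by (intro mult_left_mono) auto
  finally show ?case by (simp add: algebra_simps)
qed auto

text \<open>A point of \<open>Q\<close> with overlap at least \<open>depth S Q + n\<close> lies in a
  member of each of the \<open>n\<close> depths following that of \<open>Q\<close>. These members
  lie inside \<open>Q\<close>, so the packing sum counts the point at least \<open>n\<close>
  times.\<close>

lemma measure_Int_deep_Carleson:
  assumes Q: "Q \<in> S" and packing: "(\<Sum>P\<in>{P \<in> S. P \<subseteq> Q}. measure M P) \<le> \<Lambda> * measure M Q"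
  shows "real n * measure M (Q \<inter> deep S (depth S Q + n)) \<le> \<Lambda> * measure M Q"
proof -
  let ?d = "depth S Q"
  let ?T = "\<lambda>i. {P \<in> level S i. P \<subseteq> Q}"
  have "real n * measure M (Q \<inter> deep S (?d + n)) = (\<Sum>i\<in>{?d<..?d + n}. measure M (Q \<inter> deep S (?d + n)))"
    by simp
  also have "\<dots> \<le> (\<Sum>i\<in>{?d<..?d + n}. \<Sum>P\<in>?T i. measure M P)"
  proof (rule sum_mono)
    fix i assume i: "i \<in> {?d<..?d + n}"
    have "measure M (Q \<inter> deep S (?d + n)) \<le> (\<Sum>P\<in>?T i. measure M (P \<inter> deep S (?d + n)))"
      using i Q by (intro measure_Int_deep_le) auto
    also have "\<dots> \<le> (\<Sum>P\<in>?T i. measure M P)"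
    proof (intro sum_mono measure_mono_fmeasurable)
      fix P assume "P \<in> ?T i"
      then show "P \<in> fmeasurable M" using fmeasurable_level by blast
      then show "P \<inter> deep S (?d + n) \<in> sets M"
        using i by (intro fmeasurableD fmeasurable_Int_deep) auto
    qed simp
    finally show "measure M (Q \<inter> deep S (?d + n)) \<le> (\<Sum>P\<in>?T i. measure M P)" .
  qed
  also have "\<dots> = (\<Sum>P\<in>(\<Union>i\<in>{?d<..?d + n}. ?T i). measure M P)"
  proof (rule sum.UNION_disjoint[symmetric])
    show "\<forall>i\<in>{?d<..?d + n}. finite (?T i)" using finite_level by simp
    show "\<forall>i\<in>{?d<..?d + n}. \<forall>j\<in>{?d<..?d + n}. i \<noteq> j \<longrightarrow> ?T i \<inter> ?T j = {}"
      by (auto simp: level_def)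
  qed simp
  also have "\<dots> \<le> (\<Sum>P\<in>{P \<in> S. P \<subseteq> Q}. measure M P)"
    using finite_laminar by (intro sum_mono2) (auto simp: level_def)
  finally show ?thesis using packing by linarith
qed

text \<open>
  Either one descendant \<open>P\<close> carries almost all of the \<open>N\<close>-mass of \<open>Q\<close>, and then \<open>drop\<close> bounds
  \<open>measure M Q\<close> by the little that is left, or no descendant does, and then \<open>r > 1\<close> makes the sum of
  the \<open>r\<close>-th powers of their masses smaller than that of \<open>Q\<close> by the factor that the induction needs.
\<close>

lemma measure_Int_deep_polynomial:
  fixes N :: "'a measure" and r K :: real
  assumes N: "S \<subseteq> fmeasurable N" and r: "1 < r" and K: "0 \<le> K"
    and self: "\<And>Q. Q \<in> S \<Longrightarrow> measure M Q \<le> K * measure N Q powr r"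
    and drop: "\<And>Q P. \<lbrakk>Q \<in> S; P \<in> S; P \<subseteq> Q; depth S P = depth S Q + n\<^sub>1\<rbrakk>
      \<Longrightarrow> measure M Q \<le> K * (measure N Q - measure N P) powr r"
    and Q: "Q \<in> S"
  shows "measure M (Q \<inter> deep S (depth S Q + m * n\<^sub>1)) \<le> K * (r / (r - 1) / (m + 1) * measure N Q) powr r"
  using Q
proof (induction m arbitrary: Q)
  case 0
  have "measure M (Q \<inter> deep S (depth S Q)) \<le> measure M Q"
    using 0 depth_pos[of Q] meas
    by (intro measure_mono_fmeasurable fmeasurableD[OF fmeasurable_Int_deep]) auto
  also have "\<dots> \<le> K * measure N Q powr r" using self 0 by simp
  also have "\<dots> \<le> K * (r / (r - 1) * measure N Q) powr r"
    using r K by (intro mult_left_mono powr_mono2 mult_right_mono[of 1, simplified]) (auto simp: field_simps)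
  finally show ?case by simp
next
  case (Suc m)
  \<comment> \<open>Chosen so that \<open>s * (r - 1) = r\<close>: the gain from splitting then
    becomes exactly \<open>((m + 1) / (m + 2)) powr r\<close>, which turns the bound for
    \<open>m\<close> into that for \<open>m + 1\<close>.\<close>
  define s where "s = r / (r - 1)"
  define F where "F = measure N Q"
  let ?d = "depth S Q"
  let ?n = "?d + Suc m * n\<^sub>1"
  define T where "T = {P \<in> level S (?d + n\<^sub>1). P \<subseteq> Q}"
  have s: "1 < s" using r by (simp add: s_def field_simps)
  have F: "0 \<le> F" by (simp add: F_def)
  have T: "finite T" "pairwise disjnt T"
    using finite_level pairwise_subset[OF pairwise_disjnt_level[of "?d + n\<^sub>1"], of T] by (auto simp: T_def)
  have TD: "P \<in> S" "P \<subseteq> Q" "depth S P = ?d + n\<^sub>1" "P \<in> fmeasurable N" if "P \<in> T" for P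
    using that N by (auto simp: T_def level_def)
  have QN: "Q \<in> fmeasurable N" using Suc.prems N by auto
  have n: "0 < ?n" using depth_pos[OF Suc.prems] by simp
  show ?case
  \<comment> \<open>The threshold is the bound to be proved: a remainder this small closes the goal
    through \<open>drop\<close> alone. Otherwise every descendant has mass at most
    \<open>(1 - s / (m + 2)) * F\<close>.\<close>
  proof (cases "\<exists>P\<in>T. F - measure N P \<le> s / (m + 2) * F")
    case True
    then obtain P where P: "P \<in> T" "F - measure N P \<le> s / (m + 2) * F" by auto
    have "measure N P \<le> F"
      unfolding F_def using TD[OF P(1)] QN by (intro measure_mono_fmeasurable) auto
    have "measure M (Q \<inter> deep S ?n) \<le> measure M Q"
      using Suc.prems n meas
      by (intro measure_mono_fmeasurable fmeasurableD[OF fmeasurable_Int_deep]) auto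
    also have "\<dots> \<le> K * (F - measure N P) powr r"
      using TD[OF P(1)] Suc.prems drop[of Q P] by (simp add: F_def)
    also have "\<dots> \<le> K * (s / (m + 2) * F) powr r"
      using P(2) r K \<open>measure N P \<le> F\<close> by (intro mult_left_mono powr_mono2) auto
    finally show ?thesis by (simp add: s_def F_def add_ac)
  next
    case False
    then have small: "measure N P \<le> (1 - s / (m + 2)) * F" if "P \<in> T" for P
      using that by (force simp: algebra_simps)
    have "measure M (Q \<inter> deep S ?n) \<le> (\<Sum>P\<in>T. measure M (P \<inter> deep S ?n))"
      unfolding T_def using Suc.prems by (intro measure_Int_deep_le) auto
    also have "\<dots> \<le> (\<Sum>P\<in>T. K * (s / (m + 1) * measure N P) powr r)"
    proof (rule sum_mono)
      fix P assume P: "P \<in> T"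
      then show "measure M (P \<inter> deep S ?n) \<le> K * (s / (m + 1) * measure N P) powr r"
        using Suc.IH[of P] TD[OF P] by (simp add: s_def add_ac)
    qed
    also have "\<dots> = K * (s / (m + 1)) powr r * (\<Sum>P\<in>T. measure N P powr r)"
      by (simp only: powr_mult sum_distrib_left mult.assoc)
    also have "\<dots> \<le> K * (s / (m + 1)) powr r * ((m + 1) / (m + 2) * F) powr r"
    proof (intro mult_left_mono)
      show "(\<Sum>P\<in>T. measure N P powr r) \<le> ((m + 1) / (m + 2) * F) powr r"
      proof (cases "T = {} \<or> F = 0")
        case True
        have "measure N P = 0" if "P \<in> T" for P
          using True that small[OF that] by (auto simp: measure_le_0_iff)
        then have "(\<Sum>P\<in>T. measure N P powr r) = 0"
          by (intro sum.neutral) auto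
        then show ?thesis by simp
      next
        case False
        then obtain P where "P \<in> T" by auto
        \<comment> \<open>A mass is nonnegative, so the base \<open>1 - s / (m + 2)\<close> is too,
          as the manipulations with \<open>powr\<close> require.\<close>
        from small[OF this] have "0 \<le> (1 - s / (m + 2)) * F"
          using measure_nonneg[of N P] by linarith
        then have ge: "s / (m + 2) \<le> 1"
          using False F by (simp add: zero_le_mult_iff)
        have sum: "(\<Sum>P\<in>T. measure N P) \<le> F"
        proof -
          have "(\<Sum>P\<in>T. measure N P) = measure N (\<Union>T)"
            using T TD(4) by (intro measure_Union'[symmetric])
          also have "\<dots> \<le> F"
            unfolding F_def using T(1) TD(2,4) QN
            by (intro measure_mono_fmeasurable sets.finite_Union) blast+
          finally show ?thesis .
        qed
        have "(\<Sum>P\<in>T. measure N P powr r) \<le> ((1 - s / (m + 2)) * F) powr (r - 1) * F"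
          using r small sum by (intro sum_powr_le_powr_mult) simp_all
        also have "\<dots> = (1 - s / (m + 2)) powr (r - 1) * F powr r"
          using F False powr_add[of F "r - 1" 1] by (simp add: powr_mult)
        \<comment> \<open>Bernoulli with \<open>x = 1 / (m + 2)\<close>. Its strict hypothesis fails
          when \<open>s / (m + 2) = 1\<close>, but then the left side is 0.\<close>
        also have "\<dots> \<le> ((1 - 1 / (m + 2)) powr s) powr (r - 1) * F powr r"
        proof (intro mult_right_mono powr_mono2)
          show "1 - s / (m + 2) \<le> (1 - 1 / (m + 2)) powr s"
            using Bernoulli_inequality_powr[of "1 / (m + 2)" s] s ge
            by (cases "s / (m + 2) = 1") auto
        qed (use ge r in auto)
        also have "\<dots> = ((m + 1) / (m + 2)) powr r * F powr r"
        proof -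
          have "s * (r - 1) = r" using r by (simp add: s_def)
          moreover have "1 - 1 / real (m + 2) = (m + 1) / (m + 2)" by (simp add: field_simps)
          ultimately show ?thesis by (simp add: powr_powr)
        qed
        finally show ?thesis by (simp only: powr_mult)
      qed
    qed (use K in auto)
    also have "\<dots> = K * (s / (m + 1) * ((m + 1) / (m + 2) * F)) powr r"
      by (simp only: powr_mult mult.assoc)
    also have "s / (m + 1) * ((m + 1) / (m + 2) * F) = s / (m + 2) * F" by simp
    finally show ?thesis by (simp add: s_def F_def add_ac)
  qed
qed

text \<open>The local bound is summed over the disjoint maximal members, whose \<open>r\<close>-th
  powers of masses add up to at most \<open>F powr r\<close>.\<close>

lemma measure_deep_polynomial:
  fixes N :: "'a measure" and r K :: real
  assumes N: "S \<subseteq> fmeasurable N" and r: "1 < r" and K: "0 \<le> K" and F: "measure N (\<Union>S) \<le> F"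
    and self: "\<And>Q. Q \<in> S \<Longrightarrow> measure M Q \<le> K * measure N Q powr r"
    and drop: "\<And>Q P. \<lbrakk>Q \<in> S; P \<in> S; P \<subseteq> Q; depth S P = depth S Q + n\<^sub>1\<rbrakk>
      \<Longrightarrow> measure M Q \<le> K * (measure N Q - measure N P) powr r"
    and n: "0 < n" "0 < n\<^sub>1"
  shows "measure M (deep S n) \<le> K * (r / (r - 1) * n\<^sub>1 / n * F) powr r"
proof -
  \<comment> \<open>The number of complete blocks of \<open>n\<^sub>1\<close> generations below the
    maximal members, which already account for depth 1; hence \<open>n - 1\<close>.\<close>
  define m where "m = (n - 1) div n\<^sub>1"
  have "m * n\<^sub>1 \<le> n - 1" "n - 1 < (m + 1) * n\<^sub>1"
    using div_times_less_eq_dividend[of "n - 1" n\<^sub>1] dividend_less_div_times[OF n(2), of "n - 1"]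
    by (simp_all add: m_def add_ac)
  then have m: "1 + m * n\<^sub>1 \<le> n" "n \<le> (m + 1) * n\<^sub>1"
    using n by linarith+
  have s: "1 < r / (r - 1)" using r by (simp add: field_simps)
  have F0: "0 \<le> F" using measure_nonneg[of N "\<Union>S"] F by linarith
  have "measure M (deep S n) \<le> measure M (deep S (1 + m * n\<^sub>1))"
    using m(1) n by (intro measure_mono_fmeasurable deep_antimono fmeasurableD[OF fmeasurable_deep] fmeasurable_deep) auto
  also have "\<dots> \<le> (\<Sum>Q\<in>level S 1. measure M (Q \<inter> deep S (1 + m * n\<^sub>1)))"
    by (intro measure_deep_le) auto
  also have "\<dots> \<le> (\<Sum>Q\<in>level S 1. K * (r / (r - 1) / (m + 1) * measure N Q) powr r)"
  proof (rule sum_mono)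
    fix Q assume "Q \<in> level S 1"
    then have Q: "Q \<in> S" "depth S Q = 1" by (auto simp: level_def)
    show "measure M (Q \<inter> deep S (1 + m * n\<^sub>1)) \<le> K * (r / (r - 1) / (m + 1) * measure N Q) powr r"
    proof -
      have "measure M (Q \<inter> deep S (depth S Q + m * n\<^sub>1)) \<le> K * (r / (r - 1) / (m + 1) * measure N Q) powr r"
      proof (rule measure_Int_deep_polynomial[OF N r K])
        show "measure M Q \<le> K * measure N Q powr r" if "Q \<in> S" for Q
          using self that .
        show "measure M Q \<le> K * (measure N Q - measure N P) powr r"
          if "Q \<in> S" "P \<in> S" "P \<subseteq> Q" "depth S P = depth S Q + n\<^sub>1" for Q P
          using drop that .
      qed (rule Q(1))
      then show ?thesis using Q(2) by simp
    qed
  qed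
  also have "\<dots> = K * (r / (r - 1) / (m + 1)) powr r * (\<Sum>Q\<in>level S 1. measure N Q powr r)"
    by (simp only: powr_mult sum_distrib_left mult.assoc)
  also have "\<dots> \<le> K * (r / (r - 1) / (m + 1)) powr r * (F powr (r - 1) * F)"
  proof (intro mult_left_mono sum_powr_le_powr_mult)
    have S: "\<Union>S \<in> fmeasurable N"
      using N by (intro fmeasurable.finite_Union finite_laminar)
    have level: "finite (level S 1)" "level S 1 \<subseteq> fmeasurable N" "\<Union>(level S 1) \<subseteq> \<Union>S"
      using finite_level[of 1] level_subset[of 1] N by (blast, blast, blast)
    show "measure N Q \<le> F" if "Q \<in> level S 1" for Q
    proof -
      have "measure N Q \<le> measure N (\<Union>S)"
        using that level S level_subset[of 1] by (intro measure_mono_fmeasurable) blast+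
      with F show ?thesis by linarith
    qed
    have "(\<Sum>Q\<in>level S 1. measure N Q) = measure N (\<Union>(level S 1))"
      using level pairwise_disjnt_level[of 1] by (intro measure_Union'[symmetric]) blast+
    also have "\<dots> \<le> measure N (\<Union>S)"
      using level S by (intro measure_mono_fmeasurable sets.finite_Union) blast+
    finally show "(\<Sum>Q\<in>level S 1. measure N Q) \<le> F" using F by linarith
  qed (use r K in auto)
  also have "F powr (r - 1) * F = F powr r"
    using F0 r powr_add[of F "r - 1" 1] by (cases "F = 0") auto
  also have "K * (r / (r - 1) / (m + 1)) powr r * F powr r = K * (r / (r - 1) / (m + 1) * F) powr r"
    by (simp only: powr_mult mult.assoc)
  also have "\<dots> \<le> K * (r / (r - 1) * n\<^sub>1 / n * F) powr r"
  proof (intro mult_left_mono powr_mono2 mult_right_mono)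
    have "real n \<le> real (m + 1) * real n\<^sub>1"
      using of_nat_mono[OF m(2), where 'a = real] by (simp only: of_nat_mult)
    then have "1 / real (m + 1) \<le> real n\<^sub>1 / real n"
      using n by (simp add: field_simps)
    then have "r / (r - 1) * (1 / real (m + 1)) \<le> r / (r - 1) * (real n\<^sub>1 / real n)"
      using s by (intro mult_left_mono) auto
    then show "r / (r - 1) / real (m + 1) \<le> r / (r - 1) * real n\<^sub>1 / real n"
      by simp
  qed (use r K s F0 in auto)
  finally show ?thesis .
qed

end

end

section \<open>Dyadic cubes\<close>

text \<open>The two boxes have equal Lebesgue measure, which is therefore also that of the half-open
  cube.\<close>

lemma cube_between_boxes:
  "box a (\<chi> i. a $ i + l) \<subseteq> cube a l" "cube a l \<subseteq> cbox a (\<chi> i. a $ i + l)"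
  by (auto simp: cube_def mem_box_cart less_imp_le)

lemma cube_sets_borel [measurable]:
  fixes a :: "real ^ 'd"
  shows "cube a l \<in> sets borel"
proof -
  have "cube a l = (\<Inter>i. {x. a $ i \<le> x $ i} \<inter> {x. x $ i < a $ i + l})"
    by (auto simp: cube_def)
  moreover have "closed {x :: real ^ 'd. a $ i \<le> x $ i}" "open {x :: real ^ 'd. x $ i < a $ i + l}" for i
    by (auto intro!: closed_Collect_le open_Collect_less continuous_intros)
  ultimately show ?thesis
    by (auto intro!: sets.countable_INT' sets.Int borel_closed borel_open)
qed

lemma cube_sets_lebesgue [measurable]: "cube a l \<in> sets lebesgue"
  by (simp add: sets_completionI_sets)

lemma lmeasurable_cube: "cube a l \<in> lmeasurable"
  using fmeasurableI2[OF lmeasurable_cbox cube_between_boxes(2) cube_sets_lebesgue] .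

lemma measure_cube:
  fixes a :: "real ^ 'd"
  assumes "0 \<le> l"
  shows "measure lebesgue (cube a l) = l ^ CARD('d)" and "measure lborel (cube a l) = l ^ CARD('d)"
proof -
  let ?b = "\<chi> i. a $ i + l"
  have "cbox a ?b \<noteq> {}"
    using assms by (auto simp: interval_ne_empty_cart)
  then have cbox: "measure lebesgue (cbox a ?b) = l ^ CARD('d)"
    by (simp add: content_cbox_cart)
  have "measure lebesgue (box a ?b) = measure lebesgue (cbox a ?b)"
    by (simp add: measure_lborel_box_eq measure_lborel_cbox_eq)
  moreover have "measure lebesgue (box a ?b) \<le> measure lebesgue (cube a l)"
    by (intro measure_mono_fmeasurable cube_between_boxes lmeasurable_cube) auto
  moreover have "measure lebesgue (cube a l) \<le> measure lebesgue (cbox a ?b)"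
    by (intro measure_mono_fmeasurable cube_between_boxes) auto
  ultimately show "measure lebesgue (cube a l) = l ^ CARD('d)"
    using cbox by linarith
  then show "measure lborel (cube a l) = l ^ CARD('d)"
    by simp
qed

lemma interior_cube_nonempty: "0 < l \<Longrightarrow> interior (cube a l) \<noteq> {}"
proof -
  assume "0 < l"
  then have "(\<chi> i. a $ i + l / 2) \<in> box a (\<chi> i. a $ i + l)"
    by (simp add: mem_box_cart)
  then show ?thesis
    using interior_maximal[OF cube_between_boxes(1)[of a l] open_box] by auto
qed

context
  fixes D :: "(real ^ 'd) set set"
  assumes D: "dyadic_grid D"
begin

lemma dyadic_grid_cube: "Q \<in> D \<Longrightarrow> \<exists>a. \<exists>k::int. Q = cube a (2 powi k)"
  using D by (simp add: dyadic_grid_def)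

lemma dyadic_grid_nonempty: "D \<noteq> {}"
  using D by (auto simp: dyadic_grid_def partition_on_def)

lemma dyadic_grid_lmeasurable: "Q \<in> D \<Longrightarrow> Q \<in> lmeasurable"
  using dyadic_grid_cube lmeasurable_cube by metis

lemma dyadic_grid_measure_pos: "Q \<in> D \<Longrightarrow> 0 < measure lebesgue Q"
  using dyadic_grid_cube[of Q] by (auto simp: measure_cube)

lemma laminar_dyadic: "finite S \<Longrightarrow> S \<subseteq> D \<Longrightarrow> laminar S"
proof -
  assume S: "finite S" "S \<subseteq> D"
  have "\<forall>Q\<in>D. \<forall>R\<in>D. Q \<subseteq> R \<or> R \<subseteq> Q \<or> Q \<inter> R = {}"
    using D by (simp add: dyadic_grid_def)
  moreover have "{} \<notin> S"
    using S dyadic_grid_measure_pos[of "{}"] by auto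
  ultimately show "laminar S"
    using S unfolding laminar_def by (meson subsetD)
qed

text \<open>For each of the countably many side lengths the cubes are disjoint with nonempty
  interior. Countability lets an infinite sparse collection be exhausted by a sequence of finite
  ones.\<close>

lemma countable_dyadic_grid: "countable D"
proof -
  let ?D = "\<lambda>k::int. {Q \<in> D. \<exists>a. Q = cube a (2 powi k)}"
  have "countable (?D k)" for k
  proof (rule countable_disjoint_nonempty_interior_subsets)
    have "partition_on UNIV (?D k)"
      using D by (simp add: dyadic_grid_def)
    then show "pairwise disjnt (?D k)"
      by (auto simp: partition_on_def disjoint_def pairwise_def disjnt_def)
    show "R = {}" if "R \<in> ?D k" "interior R = {}" for R
      using that interior_cube_nonempty[of "2 powi k"] by auto
  qed
  then have "countable (\<Union>k. ?D k)" by (intro countable_UN) auto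
  moreover have "D \<subseteq> (\<Union>k. ?D k)" using dyadic_grid_cube by blast
  ultimately show ?thesis by (rule countable_subset[rotated])
qed

text \<open>Distinct cubes of the same side are disjoint, so a proper subcube has a smaller side.
  Sides are powers of two, so its side is at most half, and its volume is at most half as well since
  the dimension is at least 1.\<close>

lemma dyadic_grid_measure_psubset:
  assumes "P \<in> D" "Q \<in> D" "P \<subset> Q"
  shows "measure lebesgue P \<le> measure lebesgue Q / 2"
proof -
  obtain a b and k m :: int where P: "P = cube a (2 powi k)" and Q: "Q = cube b (2 powi m)"
    using assms dyadic_grid_cube by metis
  have n: "1 \<le> CARD('d)" by (simp add: Suc_leI)
  have "k < m"
  proof (rule ccontr)
    assume "\<not> k < m"
    have "measure lebesgue P \<le> measure lebesgue Q"
      using assms dyadic_grid_lmeasurable by (intro measure_mono_fmeasurable) auto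
    then have "(2 powi k :: real) \<le> 2 powi m"
      unfolding P Q using power_mono_iff[of "2 powi k :: real" "2 powi m" "CARD('d)"]
      by (simp add: measure_cube)
    then have "k = m"
      using \<open>\<not> k < m\<close> power_int_strict_increasing[of m k "2::real"] by force
    have "pairwise disjnt {Q \<in> D. \<exists>a. Q = cube a (2 powi m)}"
      using D by (simp add: dyadic_grid_def partition_on_def)
    from pairwiseD[OF this, of P Q] have "P \<inter> Q = {}"
      using assms P Q \<open>k = m\<close> unfolding disjnt_def by blast
    then show False
      using assms dyadic_grid_measure_pos[of P] by (auto simp: Int_absorb2)
  qed
  then have "(2 powi k :: real) \<le> 2 powi (m - 1)"
    by (intro power_int_increasing) auto
  then have "(2 powi k :: real) \<le> 2 powi m / 2"
    by (simp add: power_int_diff)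
  then have "(2 powi k :: real) ^ CARD('d) \<le> (2 powi m / 2) ^ CARD('d)"
    by (intro power_mono) auto
  also have "\<dots> \<le> (2 powi m) ^ CARD('d) / 2"
    using n power_increasing[of 1 "CARD('d)" "2::real"] by (simp add: power_divide field_simps)
  finally show ?thesis
    unfolding P Q by (simp add: measure_cube)
qed

text \<open>A point of \<open>P\<close> lies in a member of every depth between those of
  \<open>Q\<close> and \<open>P\<close>, and each step along this chain halves the volume.\<close>

lemma measure_descendant_le:
  assumes S: "finite S" "S \<subseteq> D" and "P \<in> S" "Q \<in> S" "P \<subseteq> Q" "depth S P = depth S Q + n"
  shows "measure lebesgue P \<le> measure lebesgue Q / 2 ^ n"
  using assms(3-)
proof (induction n arbitrary: P)
  case 0
  then have "P = Q"
    using depth_strict_mono[OF laminar_dyadic[OF S], of Q P] by auto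
  then show ?case by simp
next
  case (Suc n)
  note lam = laminar_dyadic[OF S]
  have "P \<noteq> {}" using Suc.prems S dyadic_grid_measure_pos[of P] by auto
  then obtain x where x: "x \<in> P" by auto
  have "depth S Q + n \<le> overlap S x"
    using depth_le_overlap[OF lam x] Suc.prems by simp
  then obtain R where R: "R \<in> S" "x \<in> R" "depth S R = depth S Q + n"
    using exists_depth_eq[OF lam, of "depth S Q + n" x] depth_pos[OF lam, of Q] Suc.prems by auto
  have "P \<subset> R"
    using subset_of_depth_le[OF lam, of R P x] R x Suc.prems by auto
  then have "measure lebesgue P \<le> measure lebesgue R / 2"
    using R Suc.prems S by (intro dyadic_grid_measure_psubset) auto
  also have "R \<subseteq> Q"
    using subset_of_depth_le[OF lam, of Q R x] R x Suc.prems by auto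
  then have "measure lebesgue R / 2 \<le> measure lebesgue Q / 2 ^ n / 2"
    using Suc.IH[of R] R Suc.prems by simp
  finally show ?case by simp
qed

text \<open>The sparseness condition in Carleson form: the disjoint sets \<open>E P\<close> with
  \<open>P \<subseteq> Q\<close> all fit into \<open>Q\<close>, and each takes at least the fraction
  \<gamma> of \<open>P\<close>.\<close>

lemma sparse_packing:
  assumes "0 < \<gamma>" and S: "sparse_collection \<gamma> S" "S' \<subseteq> S" "finite S'" "S \<subseteq> D" and Q: "Q \<in> D"
  shows "(\<Sum>P\<in>{P \<in> S'. P \<subseteq> Q}. measure lebesgue P) \<le> 1 / \<gamma> * measure lebesgue Q"
proof -
  let ?T = "{P \<in> S'. P \<subseteq> Q}"
  obtain E where E: "\<And>P. P \<in> S \<Longrightarrow> E P \<in> sets lebesgue" "\<And>P. P \<in> S \<Longrightarrow> E P \<subseteq> P"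
      "\<And>P. P \<in> S \<Longrightarrow> \<gamma> * measure lebesgue P \<le> measure lebesgue (E P)"
    and disj: "disjoint_family_on E S"
    using S(1) unfolding sparse_collection_def by blast
  have fm: "E P \<in> lmeasurable" if "P \<in> S" for P
    using fmeasurableI2[OF dyadic_grid_lmeasurable E(2) E(1)] that S by auto
  have T: "?T \<subseteq> S" "finite ?T" using S by auto
  have "\<gamma> * (\<Sum>P\<in>?T. measure lebesgue P) \<le> (\<Sum>P\<in>?T. measure lebesgue (E P))"
    unfolding sum_distrib_left using T E(3) by (intro sum_mono) auto
  also have "\<dots> = measure lebesgue (\<Union>P\<in>?T. E P)"
  proof (rule measure_UNION'[symmetric])
    show "pairwise (\<lambda>i j. disjnt (E i) (E j)) ?T"
      using disj T(1) unfolding disjoint_family_on_def pairwise_def disjnt_def by blast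
  qed (use T fm in auto)
  also have "\<dots> \<le> measure lebesgue Q"
    using T E(1,2) Q by (intro measure_mono_fmeasurable dyadic_grid_lmeasurable sets.finite_UN) blast+
  finally show ?thesis
    using \<open>0 < \<gamma>\<close> by (simp add: field_simps)
qed

end

section \<open>Weights\<close>

lemma set_nn_integral_pos:
  assumes [measurable]: "Q \<in> sets M" "g \<in> borel_measurable M"
    and "emeasure M Q \<noteq> 0" and pos: "\<And>x. 0 < g x"
  shows "(\<integral>\<^sup>+x\<in>Q. g x \<partial>M) \<noteq> 0"
proof
  assume "(\<integral>\<^sup>+x\<in>Q. g x \<partial>M) = 0"
  then have "AE x in M. g x * indicator Q x = 0"
    by (subst (asm) nn_integral_0_iff_AE) auto
  then have "AE x in M. x \<notin> Q"
    by eventually_elim (use pos in \<open>auto simp: indicator_def less_le split: if_splits\<close>)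
  then show False
    using assms(1,3) by (auto simp flip: AE_iff_null_sets)
qed

text \<open>The weight constant is assumed finite and given as a real \<open>A\<close>; when it is
  infinite the bound is trivial, which \<open>sparse_op_norm_bound\<close> treats
  separately.\<close>

locale Apq_weight =
  fixes D :: "(real ^ 'd) set set" and w :: "real ^ 'd \<Rightarrow> real" and \<alpha> p q A :: real
  assumes D: "dyadic_grid D"
    and \<alpha>: "0 < \<alpha>" "\<alpha> < real CARD('d)"
    and p: "1 < p" "p \<le> q"
    and exponents: "1 / q + \<alpha> / real CARD('d) = 1 / p"
    and w: "weight w"
    and A: "Apq_const D p q w = ennreal A" "0 \<le> A"
begin

abbreviation "p' \<equiv> conj_exp p"

text \<open>Two exponents of the volume coincide here: \<open>v / q\<close> is the one in the
  fractional average, and \<open>v = 1 + q / p'\<close> is the one in the weight condition cleared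
  of averages.\<close>

definition "v = q * (1 - \<alpha> / real CARD('d))"

abbreviation "\<omega> \<equiv> pow_measure w q"

text \<open>The mass of the dual weight. \<open>enn2real\<close> loses nothing on cubes of the grid,
  where \<open>A_bound\<close> shows the integral to be finite.\<close>

definition "\<sigma> Q = enn2real (\<integral>\<^sup>+x\<in>Q. ennreal (w x powr - p') \<partial>lebesgue)"

abbreviation "vol Q \<equiv> measure lebesgue Q"

lemma conj: "1 < p'" "1 / p + 1 / p' = 1"
  using p by (auto simp: conj_exp_def field_simps)

lemma q_over_p: "1 < q / p"
  using one_less_exponent_quotient[OF _ _ _ _ exponents] \<alpha> p by simp

lemma v_eq: "v = 1 + q / p'"
proof -
  have "1 - \<alpha> / real CARD('d) = 1 / p' + 1 / q"
    using conj exponents by linarith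
  then have "v = q * (1 / p' + 1 / q)"
    by (simp only: v_def)
  then show ?thesis
    using p by (simp add: distrib_left)
qed

lemma v: "1 < v"
  using v_eq conj p by auto

lemma w_pos: "0 < w x"
  using w by (simp add: weight_def)

lemma w_nonzero: "w x \<noteq> 0"
  using w_pos[of x] by simp

lemma w_measurable [measurable]: "w \<in> borel_measurable lebesgue"
  using w by (simp add: weight_def)

lemma sets_\<omega> [measurable_cong, simp]: "sets \<omega> = sets lebesgue"
  by (simp add: pow_measure_def)

lemma space_\<omega> [simp]: "space \<omega> = UNIV"
  by (simp add: pow_measure_def)

lemma emeasure_\<omega>: "E \<in> sets lebesgue \<Longrightarrow> emeasure \<omega> E = (\<integral>\<^sup>+x\<in>E. ennreal (w x powr q) \<partial>lebesgue)"
  unfolding pow_measure_def by (subst emeasure_density) auto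

lemma vol_pos: "Q \<in> D \<Longrightarrow> 0 < vol Q"
  by (rule dyadic_grid_measure_pos[OF D])

lemma D_lmeasurable: "Q \<in> D \<Longrightarrow> Q \<in> lmeasurable"
  by (rule dyadic_grid_lmeasurable[OF D])

lemma D_sets [measurable]: "Q \<in> D \<Longrightarrow> Q \<in> sets lebesgue"
  using D_lmeasurable by auto

text \<open>Both averages are nonzero because the weight is positive, so the finiteness of their
  product makes each of them finite.\<close>

lemma A_bound:
  assumes Q: "Q \<in> D"
  shows "emeasure \<omega> Q < \<infinity>" "0 < measure \<omega> Q"
    "(\<integral>\<^sup>+x\<in>Q. ennreal (w x powr - p') \<partial>lebesgue) = ennreal (\<sigma> Q)"
    "measure \<omega> Q * \<sigma> Q powr (q / p') \<le> A * vol Q powr v"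
proof -
  let ?X = "\<integral>\<^sup>+x\<in>Q. ennreal (w x powr q) \<partial>lebesgue"
  let ?Y = "\<integral>\<^sup>+x\<in>Q. ennreal (w x powr - p') \<partial>lebesgue"
  have V: "emeasure lebesgue Q = ennreal (vol Q)"
    using D_lmeasurable[OF Q] by (simp add: emeasure_eq_measure2)
  have V0: "emeasure lebesgue Q \<noteq> 0"
    using V vol_pos[OF Q] by simp
  have X: "?X \<noteq> 0" and Y: "?Y \<noteq> 0"
    by (intro set_nn_integral_pos V0; use Q w_nonzero in auto)+
  have A': "?X / ennreal (vol Q) * epowr (?Y / ennreal (vol Q)) (q / p') \<le> ennreal A"
    unfolding A(1)[symmetric] Apq_const_def V[symmetric] by (rule SUP_upper[OF Q])
  have XV: "?X / ennreal (vol Q) \<noteq> 0"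
    using X vol_pos[OF Q] by (simp add: ennreal_divide_eq_0_iff)
  have "?Y \<noteq> \<infinity>"
  proof
    assume "?Y = \<infinity>"
    then have "epowr (?Y / ennreal (vol Q)) (q / p') = \<infinity>"
      by (simp add: epowr_def ennreal_top_divide)
    then show False
      using A' XV by (simp add: ennreal_mult_top top_unique)
  qed
  then show Y': "?Y = ennreal (\<sigma> Q)"
    by (simp add: \<sigma>_def less_top)
  then have \<sigma>: "0 < \<sigma> Q"
    using Y by (metis \<sigma>_def enn2real_nonneg ennreal_0 less_eq_real_def)
  have e: "epowr (?Y / ennreal (vol Q)) (q / p') = ennreal ((\<sigma> Q / vol Q) powr (q / p'))"
    unfolding Y' using \<sigma> vol_pos[OF Q] by (simp add: epowr_def divide_ennreal)
  have pos: "0 < (\<sigma> Q / vol Q) powr (q / p')"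
    using \<sigma> vol_pos[OF Q] by simp
  have "?X \<noteq> \<infinity>"
  proof
    assume "?X = \<infinity>"
    then show False
      using A' pos unfolding e by (simp add: ennreal_top_divide ennreal_top_mult top_unique)
  qed
  then show fin: "emeasure \<omega> Q < \<infinity>"
    using Q by (simp add: emeasure_\<omega> less_top)
  have X': "?X = ennreal (measure \<omega> Q)"
    using fin Q by (simp add: emeasure_eq_ennreal_measure less_top flip: emeasure_\<omega>)
  then show "0 < measure \<omega> Q"
    using X by (metis measure_nonneg ennreal_0 less_eq_real_def)
  have "measure \<omega> Q / vol Q * (\<sigma> Q / vol Q) powr (q / p') \<le> A"
    using A' A(2) vol_pos[OF Q] unfolding e X'
    by (simp add: divide_ennreal flip: ennreal_mult')
  then have "measure \<omega> Q * \<sigma> Q powr (q / p') / (vol Q * vol Q powr (q / p')) \<le> A"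
    by (simp add: powr_divide)
  also have "vol Q * vol Q powr (q / p') = vol Q powr v"
    using vol_pos[OF Q] by (simp add: v_eq powr_add)
  finally show "measure \<omega> Q * \<sigma> Q powr (q / p') \<le> A * vol Q powr v"
    using vol_pos[OF Q] by (simp add: field_simps)
qed

lemma D_fmeasurable_\<omega>: "Q \<in> D \<Longrightarrow> Q \<in> fmeasurable \<omega>"
  using A_bound(1) by (auto intro!: fmeasurableI)

text \<open>The Muckenhoupt \<open>A_v\<close> property of \<open>w powr q\<close>: Hoelder's
  inequality for \<open>1 = w powr (q / v) * w powr - (q / v)\<close>, the first factor cut off to
  \<open>E\<close> and the second to \<open>Q\<close>, followed by the weight condition on
  \<open>Q\<close>.\<close>

lemma vol_powr_le:
  assumes Q: "Q \<in> D" and E: "E \<in> sets lebesgue" "E \<subseteq> Q"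
  shows "vol E powr v * measure \<omega> Q \<le> A * measure \<omega> E * vol Q powr v"
proof -
  note [measurable] = E(1)
  have fm: "E \<in> fmeasurable \<omega>"
    using fmeasurableI2[OF D_fmeasurable_\<omega>[OF Q] E(2)] E(1) by simp
  have v': "1 / v + 1 / (v / (v - 1)) = 1"
    using v by (simp add: field_simps)
  have vol: "emeasure lebesgue E = ennreal (vol E)"
    using fmeasurableI2[OF D_lmeasurable[OF Q] E(2,1)] by (simp add: emeasure_eq_measure2)
  have "emeasure lebesgue E = (\<integral>\<^sup>+x. ennreal (w x powr (q / v) * indicator E x * (w x powr - (q / v) * indicator Q x)) \<partial>lebesgue)"
    using E w_pos by (subst nn_integral_indicator[OF E(1), symmetric], intro nn_integral_cong)
      (auto simp: indicator_def powr_minus w_nonzero)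
  also have "\<dots> \<le> ennreal (measure \<omega> E powr (1 / v) * \<sigma> Q powr (1 / (v / (v - 1))))"
  proof (rule nn_integral_Holder[OF _ _ _ _ _ _ v'])
    have "(\<integral>\<^sup>+x. ennreal ((w x powr (q / v) * indicator E x) powr v) \<partial>lebesgue) = emeasure \<omega> E"
      unfolding emeasure_\<omega>[OF E(1)] using v
      by (intro nn_integral_cong) (auto simp: indicator_def powr_powr)
    then show "(\<integral>\<^sup>+x. ennreal ((w x powr (q / v) * indicator E x) powr v) \<partial>lebesgue) = ennreal (measure \<omega> E)"
      using fm by (simp add: emeasure_eq_measure2)
    have ex: "q / v * (v / (v - 1)) = p'"
    proof -
      have "q / v * (v / (v - 1)) = q / (v - 1)" using v by simp
      also have "\<dots> = p'" using conj p by (simp add: v_eq)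
      finally show ?thesis .
    qed
    have "(\<integral>\<^sup>+x. ennreal ((w x powr - (q / v) * indicator Q x) powr (v / (v - 1))) \<partial>lebesgue)
        = (\<integral>\<^sup>+x\<in>Q. ennreal (w x powr - p') \<partial>lebesgue)"
      using ex by (intro nn_integral_cong) (auto simp: indicator_def powr_powr)
    then show "(\<integral>\<^sup>+x. ennreal ((w x powr - (q / v) * indicator Q x) powr (v / (v - 1))) \<partial>lebesgue) = ennreal (\<sigma> Q)"
      using A_bound(3)[OF Q] by simp
  qed (use v Q in \<open>auto simp: \<sigma>_def\<close>)
  finally have "vol E \<le> measure \<omega> E powr (1 / v) * \<sigma> Q powr (1 / (v / (v - 1)))"
    unfolding vol by (simp add: ennreal_le_iff)
  then have "vol E powr v \<le> (measure \<omega> E powr (1 / v) * \<sigma> Q powr (1 / (v / (v - 1)))) powr v"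
    using v by (intro powr_mono2) auto
  also have "\<dots> = measure \<omega> E * \<sigma> Q powr (q / p')"
    using v by (simp add: powr_mult powr_powr v_eq)
  finally have "vol E powr v * measure \<omega> Q \<le> measure \<omega> E * \<sigma> Q powr (q / p') * measure \<omega> Q"
    by (intro mult_right_mono) auto
  also have "\<dots> \<le> measure \<omega> E * (A * vol Q powr v)"
    using A_bound(4)[OF Q] by (simp add: mult_left_mono mult.assoc mult.commute[of "measure \<omega> Q"])
  finally show ?thesis by (simp add: mult_ac)
qed

text \<open>\<open>vol_powr_le\<close> with \<open>E = Q\<close>.\<close>

lemma A_ge_1: "1 \<le> A"
proof -
  obtain Q where Q: "Q \<in> D" using dyadic_grid_nonempty[OF D] by auto
  have "1 * (vol Q powr v * measure \<omega> Q) \<le> A * (vol Q powr v * measure \<omega> Q)"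
    using vol_powr_le[OF Q D_sets[OF Q]] by (simp add: mult_ac)
  then show ?thesis
    using vol_pos[OF Q] A_bound(2)[OF Q] by (simp add: mult_le_cancel_right)
qed

text \<open>The measure \<open>f\<^sup>p w\<^sup>p dx\<close>, of total mass \<open>\<parallel>f\<parallel>\<^sup>p\<close> in \<open>L\<^sup>p(w\<^sup>p)\<close>.\<close>

definition Fm :: "(real ^ 'd \<Rightarrow> real) \<Rightarrow> (real ^ 'd) measure" where
  "Fm f = density lebesgue (\<lambda>x. ennreal (f x powr p * w x powr p))"

lemma sets_Fm [simp, measurable_cong]: "sets (Fm f) = sets lebesgue"
  by (simp add: Fm_def)

lemma space_Fm [simp]: "space (Fm f) = UNIV"
  by (simp add: Fm_def)

end

locale Apq_weight_function = Apq_weight D w \<alpha> p q A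
  for D :: "(real ^ 'd) set set" and w :: "real ^ 'd \<Rightarrow> real" and \<alpha> p q A :: real +
  fixes f :: "real ^ 'd \<Rightarrow> real"
  assumes f [measurable]: "f \<in> borel_measurable lebesgue" and f_nonneg: "0 \<le> f x"
    and f_fin: "emeasure (Fm f) UNIV < \<infinity>"
begin

lemma fmeasurable_Fm: "E \<in> sets lebesgue \<Longrightarrow> E \<in> fmeasurable (Fm f)"
  using f_fin emeasure_mono[of E UNIV "Fm f"] by (auto intro!: fmeasurableI)

definition "mass E = enn2real (\<integral>\<^sup>+x\<in>E. ennreal (f x) \<partial>lebesgue)"

text \<open>Hoelder's inequality for \<open>f = (f * w) * inverse w\<close>. The cutoff to
  \<open>E\<close> goes with \<open>f * w\<close>, while the dual weight is integrated over all of
  \<open>Q\<close>, where the weight condition applies. Thus \<open>E\<close> need not be a cube;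
  later it is also a difference \<open>Q - P\<close>.\<close>

lemma mass_Holder:
  assumes Q: "Q \<in> D" and E: "E \<in> sets lebesgue" "E \<subseteq> Q"
  shows "(\<integral>\<^sup>+x\<in>E. ennreal (f x) \<partial>lebesgue) = ennreal (mass E)"
    "mass E powr q * measure \<omega> Q \<le> A * measure (Fm f) E powr (q / p) * vol Q powr v"
proof -
  note [measurable] = E(1)
  have "(\<integral>\<^sup>+x\<in>E. ennreal (f x) \<partial>lebesgue)
      = (\<integral>\<^sup>+x. ennreal (f x * w x * indicator E x * (inverse (w x) * indicator Q x)) \<partial>lebesgue)"
    using E w_pos by (intro nn_integral_cong)
      (auto simp: indicator_def w_nonzero mult.assoc)
  also have "\<dots> \<le> ennreal (measure (Fm f) E powr (1 / p) * \<sigma> Q powr (1 / p'))"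
  proof (rule nn_integral_Holder[OF _ _ _ _ _ _ conj(2)])
    have "(\<integral>\<^sup>+x. ennreal ((f x * w x * indicator E x) powr p) \<partial>lebesgue) = emeasure (Fm f) E"
      unfolding Fm_def using p by (subst emeasure_density)
        (auto intro!: nn_integral_cong simp: indicator_def powr_mult)
    then show "(\<integral>\<^sup>+x. ennreal ((f x * w x * indicator E x) powr p) \<partial>lebesgue) = ennreal (measure (Fm f) E)"
      using fmeasurable_Fm[OF E(1)] by (simp add: emeasure_eq_measure2)
    have "(\<integral>\<^sup>+x. ennreal ((inverse (w x) * indicator Q x) powr p') \<partial>lebesgue)
        = (\<integral>\<^sup>+x\<in>Q. ennreal (w x powr - p') \<partial>lebesgue)"
      using w_pos by (intro nn_integral_cong)
        (auto simp: indicator_def powr_minus inverse_powr less_imp_le)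
    then show "(\<integral>\<^sup>+x. ennreal ((inverse (w x) * indicator Q x) powr p') \<partial>lebesgue) = ennreal (\<sigma> Q)"
      using A_bound(3)[OF Q] by simp
  qed (use p conj Q f_nonneg w_pos in \<open>auto simp: \<sigma>_def less_imp_le\<close>)
  finally have le: "(\<integral>\<^sup>+x\<in>E. ennreal (f x) \<partial>lebesgue) \<le> ennreal (measure (Fm f) E powr (1 / p) * \<sigma> Q powr (1 / p'))" .
  then have "(\<integral>\<^sup>+x\<in>E. ennreal (f x) \<partial>lebesgue) < \<infinity>"
    using le_less_trans by fastforce
  then show m: "(\<integral>\<^sup>+x\<in>E. ennreal (f x) \<partial>lebesgue) = ennreal (mass E)"
    by (simp add: mass_def)
  have m0: "0 \<le> mass E" by (simp add: mass_def)
  have "mass E \<le> measure (Fm f) E powr (1 / p) * \<sigma> Q powr (1 / p')"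
    using le unfolding m by (simp add: ennreal_le_iff)
  then have "mass E powr q \<le> (measure (Fm f) E powr (1 / p) * \<sigma> Q powr (1 / p')) powr q"
    using p m0 by (intro powr_mono2) auto
  also have "\<dots> = measure (Fm f) E powr (q / p) * \<sigma> Q powr (q / p')"
    by (simp add: powr_mult powr_powr)
  finally have "mass E powr q * measure \<omega> Q \<le> measure (Fm f) E powr (q / p) * \<sigma> Q powr (q / p') * measure \<omega> Q"
    by (intro mult_right_mono) auto
  also have "\<dots> \<le> measure (Fm f) E powr (q / p) * (A * vol Q powr v)"
    using A_bound(4)[OF Q] by (simp add: mult_left_mono mult.assoc mult.commute[of "measure \<omega> Q"])
  finally show "mass E powr q * measure \<omega> Q \<le> A * measure (Fm f) E powr (q / p) * vol Q powr v"
    by (simp add: mult_ac)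
qed

end

section \<open>Level sets of the overlap count\<close>

text \<open>The constant of \<open>measure_deep_level_decay\<close>. The factors
  \<open>2 * c\<close> and \<open>(2 * n\<^sub>0 * 2 powr v) powr \<beta>\<close> stem from the
  geometric decay, the last one from the polynomial decay. Neither the weight nor \<open>A\<close>
  enters.\<close>

definition level_const :: "real \<Rightarrow> real \<Rightarrow> real \<Rightarrow> nat \<Rightarrow> nat \<Rightarrow> real \<Rightarrow> real" where
  "level_const r v \<beta> n\<^sub>0 n\<^sub>1 c = 2 * c * (2 * n\<^sub>0 * 2 powr v) powr \<beta> * (2 * (r / (r - 1)) * n\<^sub>1) powr r"

context Apq_weight_function begin

abbreviation "F \<equiv> measure (Fm f) UNIV"

text \<open>Used with \<open>E = Q\<close> and with \<open>E = Q - P\<close>; the factor 1/2 leaves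
  room for the mass lost to \<open>P\<close>.\<close>

lemma \<omega>_le_of_mass_ge:
  assumes Q: "Q \<in> D" and E: "E \<in> sets lebesgue" "E \<subseteq> Q" and \<tau>: "0 < \<tau>"
    and mass: "\<tau> / 2 * vol Q powr (v / q) \<le> mass E"
  shows "measure \<omega> Q \<le> A * (2 / \<tau>) powr q * measure (Fm f) E powr (q / p)"
proof -
  have "(\<tau> / 2 * vol Q powr (v / q)) powr q \<le> mass E powr q"
    using mass \<tau> p by (intro powr_mono2) auto
  then have "(\<tau> / 2) powr q * vol Q powr v * measure \<omega> Q \<le> mass E powr q * measure \<omega> Q"
    using p by (intro mult_right_mono) (auto simp: powr_mult powr_powr powr_divide)
  also have "\<dots> \<le> A * measure (Fm f) E powr (q / p) * vol Q powr v"
    by (rule mass_Holder(2)[OF Q E])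
  finally have "(\<tau> / 2) powr q * measure \<omega> Q \<le> A * measure (Fm f) E powr (q / p)"
    using vol_pos[OF Q] by (simp add: mult.assoc mult.left_commute[of _ "vol Q powr v"] mult.commute[of _ "vol Q powr v"])
  then show ?thesis
    using \<tau> by (simp add: powr_divide field_simps)
qed

lemma mass_nonneg [simp]: "0 \<le> mass E"
  by (simp add: mass_def)

lemma mass_Diff:
  assumes Q: "Q \<in> D" and P: "P \<in> D" "P \<subseteq> Q"
  shows "mass Q = mass P + mass (Q - P)"
proof -
  have "ennreal (mass Q) = (\<integral>\<^sup>+x\<in>P \<union> (Q - P). ennreal (f x) \<partial>lebesgue)"
    using mass_Holder(1)[OF Q D_sets[OF Q]] P by (simp add: Un_absorb1)
  also have "\<dots> = (\<integral>\<^sup>+x\<in>P. ennreal (f x) \<partial>lebesgue) + (\<integral>\<^sup>+x\<in>Q - P. ennreal (f x) \<partial>lebesgue)"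
    using P Q by (intro nn_integral_disjoint_pair) auto
  also have "\<dots> = ennreal (mass P + mass (Q - P))"
    using mass_Holder(1)[OF P(1) D_sets[OF P(1)]] mass_Holder(1)[OF Q, of "Q - P"] P Q D_sets
    by simp
  finally show ?thesis
    by (simp del: ennreal_plus)
qed

context
  fixes S :: "(real ^ 'd) set set" and \<tau> :: real and n\<^sub>1 :: nat
  assumes S: "finite S" "S \<subseteq> D" and \<tau>: "0 < \<tau>"
    and low: "\<And>Q. Q \<in> S \<Longrightarrow> \<tau> * vol Q powr (v / q) \<le> mass Q"
    and upp: "\<And>Q. Q \<in> S \<Longrightarrow> mass Q \<le> 2 * \<tau> * vol Q powr (v / q)"
    and n\<^sub>1: "2 \<le> n\<^sub>1 * (v / q)"
begin

lemma laminar_S: "laminar S"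
  by (rule laminar_dyadic[OF D S])

lemma S_fmeasurable: "S \<subseteq> fmeasurable \<omega>" "S \<subseteq> fmeasurable (Fm f)" "S \<subseteq> lmeasurable"
  using S D_fmeasurable_\<omega> fmeasurable_Fm D_lmeasurable D_sets by blast+

lemma measure_deep_level:
  assumes "0 < n"
  shows "measure \<omega> (deep S n) \<le> A * (2 / \<tau>) powr q * ((q / p) / (q / p - 1) * n\<^sub>1 / n * F) powr (q / p)"
proof (rule measure_deep_polynomial[OF laminar_S S_fmeasurable(1,2) q_over_p])
  show "0 \<le> A * (2 / \<tau>) powr q" using A by simp
  show "measure (Fm f) (\<Union>S) \<le> F"
    using S S_fmeasurable(2) fmeasurable_Fm
    by (intro measure_mono_fmeasurable sets.finite_Union) auto
  show "measure \<omega> Q \<le> A * (2 / \<tau>) powr q * measure (Fm f) Q powr (q / p)" if "Q \<in> S" for Q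
  proof (rule \<omega>_le_of_mass_ge[OF _ _ _ \<tau>])
    have "\<tau> / 2 * vol Q powr (v / q) \<le> \<tau> * vol Q powr (v / q)"
      using \<tau> by (intro mult_right_mono) auto
    then show "\<tau> / 2 * vol Q powr (v / q) \<le> mass Q"
      using low[OF that] by linarith
  qed (use that S D_sets in auto)
  show "measure \<omega> Q \<le> A * (2 / \<tau>) powr q * (measure (Fm f) Q - measure (Fm f) P) powr (q / p)"
    if *: "Q \<in> S" "P \<in> S" "P \<subseteq> Q" "depth S P = depth S Q + n\<^sub>1" for Q P
  proof -
    have QP: "Q \<in> D" "P \<in> D" using * S by auto
    have "vol P powr (v / q) \<le> (vol Q / 2 ^ n\<^sub>1) powr (v / q)"
      using measure_descendant_le[OF D S *(2,1,3,4)] v p by (intro powr_mono2) auto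
    also have "\<dots> = vol Q powr (v / q) * 2 powr - (n\<^sub>1 * (v / q))"
      by (simp add: powr_divide powr_powr powr_minus_divide flip: powr_realpow)
    \<comment> \<open>The choice of \<open>n\<^sub>1\<close> gains a factor 4: one factor 2 absorbs
      the gap between \<open>upp\<close> and \<open>low\<close>, the other leaves at least half of
      the lower bound for the mass outside \<open>P\<close>.\<close>
    also have "\<dots> \<le> vol Q powr (v / q) * 2 powr - 2"
      using n\<^sub>1 by (intro mult_left_mono powr_mono) auto
    finally have "2 * \<tau> * vol P powr (v / q) \<le> \<tau> / 2 * vol Q powr (v / q)"
      using \<tau> by (simp add: powr_minus_divide)
    then have "\<tau> / 2 * vol Q powr (v / q) \<le> mass (Q - P)"
      using low[OF *(1)] upp[OF *(2)] mass_Diff[OF QP *(3)] by linarith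
    then have "measure \<omega> Q \<le> A * (2 / \<tau>) powr q * measure (Fm f) (Q - P) powr (q / p)"
      using QP D_sets by (intro \<omega>_le_of_mass_ge \<tau>) auto
    also have "measure (Fm f) (Q - P) = measure (Fm f) Q - measure (Fm f) P"
      using QP D_sets *(3) fmeasurable_Fm[of Q] by (intro measure_Diff) (auto dest: fmeasurableD2)
    finally show ?thesis .
  qed
  show "0 < n" by fact
  show "0 < n\<^sub>1" using n\<^sub>1 by (intro gr0I) auto
qed

text \<open>With \<open>n\<^sub>0 \<ge> 2 * \<Lambda>\<close> the deep part of \<open>Q\<close> has
  at most half its volume. The rest has at least half, hence by \<open>vol_powr_le\<close> at least
  the fraction \<open>2 powr - v / A\<close> of the weighted measure.\<close>

lemma measure_Int_deep_decay:
  assumes packing: "\<And>Q. Q \<in> S \<Longrightarrow> (\<Sum>P\<in>{P \<in> S. P \<subseteq> Q}. vol P) \<le> \<Lambda> * vol Q"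
    and n\<^sub>0: "2 * \<Lambda> \<le> real n\<^sub>0" "0 < n\<^sub>0" and Q: "Q \<in> S"
  shows "measure \<omega> (Q \<inter> deep S (depth S Q + n\<^sub>0)) \<le> (1 - 2 powr - v / A) * measure \<omega> Q"
proof -
  let ?B = "Q \<inter> deep S (depth S Q + n\<^sub>0)"
  let ?E = "Q - ?B"
  have QD: "Q \<in> D" using Q S by auto
  have B: "?B \<in> sets lebesgue"
    using fmeasurable_Int_deep[OF laminar_S S_fmeasurable(3)] S_fmeasurable(3) Q n\<^sub>0(2) by auto
  have "real n\<^sub>0 * vol ?B \<le> \<Lambda> * vol Q"
    using measure_Int_deep_Carleson[OF laminar_S S_fmeasurable(3) Q packing[OF Q]] .
  also have "\<dots> \<le> real n\<^sub>0 / 2 * vol Q"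
    using n\<^sub>0 by (intro mult_right_mono) auto
  finally have "vol ?B \<le> vol Q / 2"
    using n\<^sub>0 by simp
  moreover have "vol ?E = vol Q - vol ?B"
    using B D_sets[OF QD] fmeasurableD2[OF D_lmeasurable[OF QD]] by (intro measure_Diff) auto
  ultimately have "(vol Q / 2) powr v \<le> vol ?E powr v"
    using v by (intro powr_mono2) auto
  then have "(vol Q / 2) powr v * measure \<omega> Q \<le> vol ?E powr v * measure \<omega> Q"
    by (intro mult_right_mono) auto
  also have "\<dots> \<le> A * measure \<omega> ?E * vol Q powr v"
    using B QD D_sets by (intro vol_powr_le) auto
  finally have "2 powr - v * measure \<omega> Q \<le> A * measure \<omega> ?E"
    using vol_pos[OF QD] by (simp add: powr_divide powr_minus field_simps)
  then have "2 powr - v / A * measure \<omega> Q \<le> measure \<omega> ?E"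
    using A_ge_1 by (simp add: field_simps)
  also have "measure \<omega> ?E = measure \<omega> Q - measure \<omega> ?B"
    using B QD D_fmeasurable_\<omega>[OF QD] by (intro measure_Diff) (auto dest: fmeasurableD2)
  finally show ?thesis by (simp add: algebra_simps)
qed

lemma measure_deep_level_decay:
  assumes packing: "\<And>Q. Q \<in> S \<Longrightarrow> (\<Sum>P\<in>{P \<in> S. P \<subseteq> Q}. vol P) \<le> \<Lambda> * vol Q"
    and n\<^sub>0: "2 * \<Lambda> \<le> real n\<^sub>0" "0 < n\<^sub>0"
    and \<beta>: "0 \<le> \<beta>" and c: "\<And>x. 0 < x \<Longrightarrow> exp (- x) \<le> c * x powr - \<beta>" and n: "0 < n"
  shows "measure \<omega> (deep S n) \<le> level_const (q / p) v \<beta> n\<^sub>0 n\<^sub>1 c * A * (2 / \<tau>) powr q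
    * (F / n) powr (q / p) * (A / n) powr \<beta>"
proof -
  define \<rho> where "\<rho> = 1 - 2 powr - v / A"
  \<comment> \<open>About half of the depth \<open>n\<close> goes to \<open>j\<close> blocks of
    geometric decay. The other part \<open>i \<ge> n / 2\<close> is left for the polynomial bound,
    so both decays hold at once.\<close>
  define j where "j = n div (2 * n\<^sub>0)"
  define i where "i = n - j * n\<^sub>0"
  define r where "r = q / p"
  define s where "s = r / (r - 1)"
  have "1 < r" using q_over_p by (simp add: r_def)
  then have s: "1 < s" by (simp add: s_def field_simps)
  have "j * (2 * n\<^sub>0) \<le> n" "n < 2 * n\<^sub>0 + j * (2 * n\<^sub>0)"
    unfolding j_def using n\<^sub>0(2) by (auto intro: dividend_less_div_times)
  then have "j * n\<^sub>0 + j * n\<^sub>0 \<le> n" "n < 2 * n\<^sub>0 + (j * n\<^sub>0 + j * n\<^sub>0)"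
    by (simp_all add: mult_2 distrib_left)
  then have ij: "n = i + j * n\<^sub>0" "n \<le> 2 * i" "n \<le> 2 * n\<^sub>0 * (j + 1)"
    by (simp_all add: i_def algebra_simps)
  have i: "0 < i" using n ij(2) by linarith
  have "2 powr - v \<le> 2 powr - 1" using v by (intro powr_mono) auto
  then have "2 powr - v \<le> 1 / 2" by (simp add: powr_minus_divide)
  moreover have "2 powr - v / A \<le> 2 powr - v / 1"
    using A_ge_1 by (intro divide_left_mono) auto
  ultimately have \<rho>: "1 / 2 \<le> \<rho>" unfolding \<rho>_def by linarith
  \<comment> \<open>Rounding down loses up to one block, and
    \<open>n \<le> 2 * n\<^sub>0 * (j + 1)\<close> needs \<open>j + 1\<close>. As
    \<open>\<rho> \<ge> 1 / 2\<close>, the extra factor costs only 2.\<close>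
  have "\<rho> ^ j \<le> 2 * \<rho> ^ (j + 1)"
    using \<rho> mult_right_mono[of 1 "2 * \<rho>" "\<rho> ^ j"] by simp
  also have "\<rho> ^ (j + 1) \<le> exp (- (2 powr - v / A)) ^ (j + 1)"
  proof (rule power_mono)
    show "\<rho> \<le> exp (- (2 powr - v / A))"
      unfolding \<rho>_def using exp_ge_add_one_self[of "- (2 powr - v / A)"] by linarith
    show "0 \<le> \<rho>" using \<rho> by linarith
  qed
  also have "\<dots> = exp (- ((j + 1) * (2 powr - v / A)))"
    by (simp only: exp_of_nat_mult[symmetric] mult_minus_right)
  also have "\<dots> \<le> exp (- (2 powr - v * n / (2 * n\<^sub>0 * A)))"
  proof -
    have "real n \<le> real (2 * n\<^sub>0 * (j + 1))" using ij(3) by (simp only: of_nat_le_iff)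
    then have "2 powr - v * n \<le> 2 powr - v * (2 * n\<^sub>0 * (j + 1))"
      by (intro mult_left_mono) auto
    then show ?thesis using n\<^sub>0 A_ge_1 by (simp add: field_simps)
  qed
  also have "\<dots> \<le> c * (2 powr - v * n / (2 * n\<^sub>0 * A)) powr - \<beta>"
    using n n\<^sub>0 A_ge_1 by (intro c) auto
  also have "(2 powr - v * n / (2 * n\<^sub>0 * A)) powr - \<beta> = ((2 * n\<^sub>0 * 2 powr v) * (A / n)) powr \<beta>"
    using n n\<^sub>0 A_ge_1 by (simp add: powr_minus powr_divide powr_mult field_simps)
  also have "\<dots> = (2 * n\<^sub>0 * 2 powr v) powr \<beta> * (A / n) powr \<beta>"
    by (rule powr_mult)
  finally have \<rho>j: "\<rho> ^ j \<le> 2 * c * (2 * n\<^sub>0 * 2 powr v) powr \<beta> * (A / n) powr \<beta>"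
    by simp
  have "measure \<omega> (deep S i) \<le> A * (2 / \<tau>) powr q * (s * n\<^sub>1 / i * F) powr r"
    using measure_deep_level[OF i] by (simp add: s_def r_def)
  also have "\<dots> \<le> A * (2 / \<tau>) powr q * ((2 * s * n\<^sub>1) * (F / n)) powr r"
  proof (intro mult_left_mono powr_mono2)
    have "real n \<le> 2 * real i" using ij(2) by linarith
    then have "1 / real i \<le> 2 / real n" using i n by (simp add: field_simps)
    then have "(s * n\<^sub>1 * F) * (1 / real i) \<le> (s * n\<^sub>1 * F) * (2 / real n)"
      using s by (intro mult_left_mono) auto
    then show "s * n\<^sub>1 / i * F \<le> (2 * s * n\<^sub>1) * (F / n)" by (simp add: mult_ac)
  qed (use A s q_over_p in \<open>auto simp: r_def\<close>)
  also have "((2 * s * n\<^sub>1) * (F / n)) powr r = (2 * s * n\<^sub>1) powr r * (F / n) powr r"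
    by (rule powr_mult)
  finally have deep_i: "measure \<omega> (deep S i) \<le> A * (2 / \<tau>) powr q * ((2 * s * n\<^sub>1) powr r * (F / n) powr r)" .
  have "measure \<omega> (deep S n) \<le> \<rho> ^ j * measure \<omega> (deep S i)"
    unfolding ij(1)
  proof (rule measure_deep_geometric[OF laminar_S S_fmeasurable(1)])
    show "measure \<omega> (Q \<inter> deep S (depth S Q + n\<^sub>0)) \<le> \<rho> * measure \<omega> Q" if "Q \<in> S" for Q
      unfolding \<rho>_def by (rule measure_Int_deep_decay[OF packing n\<^sub>0 that])
  qed (use \<rho> i in auto)
  also have "\<dots> \<le> (2 * c * (2 * n\<^sub>0 * 2 powr v) powr \<beta> * (A / n) powr \<beta>)
      * (A * (2 / \<tau>) powr q * ((2 * s * n\<^sub>1) powr r * (F / n) powr r))"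
  proof (intro mult_mono \<rho>j deep_i measure_nonneg)
    have "0 \<le> \<rho> ^ j" using \<rho> by simp
    then show "0 \<le> 2 * c * (2 * n\<^sub>0 * 2 powr v) powr \<beta> * (A / n) powr \<beta>"
      using \<rho>j by (rule order_trans)
  qed
  finally show ?thesis
    by (simp add: level_const_def s_def r_def mult_ac)
qed

end

end

section \<open>Summation over the levels\<close>

text \<open>If every count were at most its threshold, the bands would contribute at most the sum of
  \<open>(2 * \<tau> j)\<^sup>2 * m j\<close>, which is at most \<open>t\<^sup>2\<close>. The scale
  \<open>s\<close> cancels in these products, so it can be chosen freely.\<close>

lemma level_pigeonhole:
  fixes a :: "'a set \<Rightarrow> real" and t s \<epsilon> :: real
  assumes S: "finite S" and a: "\<And>Q. Q \<in> S \<Longrightarrow> 0 \<le> a Q" and ts: "0 < t" "0 < s" and \<epsilon>: "0 < \<epsilon>"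
  defines "\<tau> \<equiv> \<lambda>j::int. t * s * 2 powr (- real_of_int j - 1)"
  defines "m \<equiv> \<lambda>j::int. (1 - 2 powr - \<epsilon>) / 2 * 2 powr - (\<epsilon> * \<bar>real_of_int j\<bar>) * 4 powr real_of_int j / s\<^sup>2"
  shows "\<exists>J. finite J \<and> {x. t\<^sup>2 < (\<Sum>Q\<in>S. (a Q)\<^sup>2 * indicator Q x)}
    \<subseteq> (\<Union>j\<in>J. {x. m j < real (overlap {Q \<in> S. \<tau> j < a Q \<and> a Q \<le> 2 * \<tau> j} x)})"
proof -
  define S' where "S' = {Q \<in> S. 0 < a Q}"
  \<comment> \<open>The index of the band of \<open>Q\<close>: the floor gives
    \<open>\<tau> (k Q) < a Q \<le> 2 * \<tau> (k Q)\<close>.\<close>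
  define k where "k = (\<lambda>Q. \<lfloor>log 2 (t * s / a Q)\<rfloor>)"
  define J where "J = k ` S'"
  let ?T = "\<lambda>j. {Q \<in> S. \<tau> j < a Q \<and> a Q \<le> 2 * \<tau> j}"
  have fin: "finite S'" "finite J" using S by (auto simp: S'_def J_def)
  have k: "Q \<in> ?T (k Q)" if "Q \<in> S'" for Q
  proof -
    have Q: "Q \<in> S" "0 < a Q" using that by (auto simp: S'_def)
    have "2 powr real_of_int (k Q) \<le> 2 powr log 2 (t * s / a Q)"
      by (intro powr_mono) (auto simp: k_def)
    moreover have "2 powr log 2 (t * s / a Q) < 2 powr (real_of_int (k Q) + 1)"
      by (intro powr_less_mono) (auto simp: k_def)
    ultimately have "2 powr real_of_int (k Q) * a Q \<le> t * s" "t * s < 2 * 2 powr real_of_int (k Q) * a Q"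
      using ts Q by (auto simp: powr_add field_simps)
    then show ?thesis
      using Q by (simp add: \<tau>_def powr_diff powr_minus field_simps)
  qed
  have "x \<in> (\<Union>j\<in>J. {x. m j < real (overlap (?T j) x)})"
    if x: "t\<^sup>2 < (\<Sum>Q\<in>S. (a Q)\<^sup>2 * indicator Q x)" for x
  proof (rule ccontr)
    assume "x \<notin> (\<Union>j\<in>J. {x. m j < real (overlap (?T j) x)})"
    then have le: "real (overlap (?T j) x) \<le> m j" if "j \<in> J" for j
      using that by force
    have "(\<Sum>Q\<in>S. (a Q)\<^sup>2 * indicator Q x) = (\<Sum>Q\<in>S'. (a Q)\<^sup>2 * indicator Q x)"
      using S a by (intro sum.mono_neutral_right) (force simp: S'_def)+
    also have "\<dots> = (\<Sum>j\<in>J. \<Sum>Q\<in>{Q \<in> S'. k Q = j}. (a Q)\<^sup>2 * indicator Q x)"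
      unfolding J_def using fin(1) by (rule sum.image_gen)
    also have "\<dots> \<le> (\<Sum>j\<in>J. (2 * \<tau> j)\<^sup>2 * m j)"
    proof (rule sum_mono)
      fix j assume j: "j \<in> J"
      have "(\<Sum>Q\<in>{Q \<in> S'. k Q = j}. (a Q)\<^sup>2 * indicator Q x) \<le> (\<Sum>Q\<in>{Q \<in> S'. k Q = j}. (2 * \<tau> j)\<^sup>2 * indicator Q x)"
        using k by (intro sum_mono mult_right_mono power_mono) (auto simp: S'_def)
      also have "\<dots> \<le> (\<Sum>Q\<in>?T j. (2 * \<tau> j)\<^sup>2 * indicator Q x)"
        using k S by (intro sum_mono2) auto
      also have "\<dots> = (2 * \<tau> j)\<^sup>2 * (\<Sum>Q\<in>?T j. indicator Q x)"
        by (simp add: sum_distrib_left)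
      also have "(\<Sum>Q\<in>?T j. indicator Q x) = real (overlap (?T j) x)"
        using S by (simp add: overlap_def indicator_def sum.If_cases Int_def flip: of_bool_def)
      also have "(2 * \<tau> j)\<^sup>2 * real (overlap (?T j) x) \<le> (2 * \<tau> j)\<^sup>2 * m j"
        using le[OF j] by (intro mult_left_mono) auto
      finally show "(\<Sum>Q\<in>{Q \<in> S'. k Q = j}. (a Q)\<^sup>2 * indicator Q x) \<le> (2 * \<tau> j)\<^sup>2 * m j" .
    qed
    also have "\<dots> = (\<Sum>j\<in>J. t\<^sup>2 * ((1 - 2 powr - \<epsilon>) / 2) * 2 powr - (\<epsilon> * \<bar>real_of_int j\<bar>))"
    proof (rule sum.cong[OF refl])
      fix j :: int
      have "2 * \<tau> j = t * s / 2 powr real_of_int j"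
        by (simp add: \<tau>_def powr_diff powr_minus field_simps)
      moreover have "(4::real) powr real_of_int j = (2 powr real_of_int j)\<^sup>2"
        using powr_powr[of 2 2 "real_of_int j"] powr_powr[of 2 "real_of_int j" 2]
        by (simp add: mult.commute)
      ultimately show "(2 * \<tau> j)\<^sup>2 * m j = t\<^sup>2 * ((1 - 2 powr - \<epsilon>) / 2) * 2 powr - (\<epsilon> * \<bar>real_of_int j\<bar>)"
        using ts by (simp add: m_def power_divide power_mult_distrib)
    qed
    also have "\<dots> = t\<^sup>2 * ((1 - 2 powr - \<epsilon>) / 2) * (\<Sum>j\<in>J. 2 powr - (\<epsilon> * \<bar>real_of_int j\<bar>))"
      by (simp add: sum_distrib_left)
    \<comment> \<open>The constant in \<open>m\<close> is the reciprocal of the geometric series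
      bound.\<close>
    also have "\<dots> \<le> t\<^sup>2 * ((1 - 2 powr - \<epsilon>) / 2) * (2 / (1 - 2 powr - \<epsilon>))"
      using \<epsilon> fin sum_powr_abs_int_le[OF \<epsilon> fin(2)] powr_mono[of "- \<epsilon>" 0 2]
      by (intro mult_left_mono) auto
    also have "\<dots> = t\<^sup>2"
      using \<epsilon> powr_less_mono[of "- \<epsilon>" 0 2] by simp
    finally show False using x by simp
  qed
  then show ?thesis using fin by blast
qed

text \<open>\<open>2 powr (q * j)\<close> is the growth of the \<open>-q\<close>-th power of the
  level and \<open>x powr - \<rho>\<close> the decay in the count. Since the count is of order
  \<open>4 powr j\<close>, the net exponent is \<open>q - 2 * \<rho>\<close>, up to a loss
  controlled by \<epsilon>.\<close>

lemma powr_geometric_bound: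
  fixes c \<epsilon> \<rho> q x :: real and j :: int
  assumes "0 < c" "0 \<le> \<rho>" "c * 2 powr - (\<epsilon> * \<bar>real_of_int j\<bar>) * 4 powr real_of_int j \<le> x"
  shows "2 powr (q * j) * x powr - \<rho> \<le> c powr - \<rho> * 2 powr ((q - 2 * \<rho>) * j + \<epsilon> * \<rho> * \<bar>real_of_int j\<bar>)"
proof -
  have "(4::real) powr real_of_int j = 2 powr (2 * j)"
    using powr_powr[of 2 2 "real_of_int j"] by simp
  then have y: "c * 2 powr - (\<epsilon> * \<bar>real_of_int j\<bar>) * 4 powr real_of_int j = c * 2 powr (2 * j - \<epsilon> * \<bar>real_of_int j\<bar>)"
    by (simp add: mult.assoc flip: powr_add)
  have "x powr - \<rho> \<le> (c * 2 powr (2 * j - \<epsilon> * \<bar>real_of_int j\<bar>)) powr - \<rho>"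
    using assms unfolding y by (intro powr_mono2') auto
  also have "\<dots> = c powr - \<rho> * 2 powr (- \<rho> * (2 * j - \<epsilon> * \<bar>real_of_int j\<bar>))"
    by (simp add: powr_mult powr_powr mult.commute)
  finally have "2 powr (q * j) * x powr - \<rho>
      \<le> 2 powr (q * j) * (c powr - \<rho> * 2 powr (- \<rho> * (2 * j - \<epsilon> * \<bar>real_of_int j\<bar>)))"
    by (intro mult_left_mono) auto
  also have "\<dots> = c powr - \<rho> * 2 powr (q * j + - \<rho> * (2 * j - \<epsilon> * \<bar>real_of_int j\<bar>))"
    by (simp only: powr_add mult_ac)
  also have "q * j + - \<rho> * (2 * j - \<epsilon> * \<bar>real_of_int j\<bar>) = (q - 2 * \<rho>) * j + \<epsilon> * \<rho> * \<bar>real_of_int j\<bar>"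
    by (simp add: algebra_simps)
  finally show ?thesis .
qed

text \<open>Counts are integers; the \<open>+ 1\<close> encodes the strict inequality and keeps the
  index positive.\<close>

lemma superlevel_overlap_eq_deep:
  assumes "0 \<le> m"
  shows "{x. m < real (overlap S x)} = deep S (nat \<lfloor>m\<rfloor> + 1)"
proof -
  have "m < real k \<longleftrightarrow> nat \<lfloor>m\<rfloor> + 1 \<le> k" for k
    using assms by linarith
  then show ?thesis by (simp add: deep_def)
qed

context Apq_weight_function begin

text \<open>The real form of \<open>frac_avg\<close> on cubes of the grid, as
  \<open>v / q = 1 - \<alpha> / d\<close>.\<close>

definition "avg Q = mass Q / vol Q powr (v / q)"

lemma avg_nonneg: "0 \<le> avg Q"
  by (simp add: avg_def)

context
  fixes S :: "(real ^ 'd) set set" and n\<^sub>0 n\<^sub>1 :: nat and \<Lambda> :: real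
  assumes S: "finite S" "S \<subseteq> D"
    and packing: "\<And>Q. Q \<in> S \<Longrightarrow> (\<Sum>P\<in>{P \<in> S. P \<subseteq> Q}. vol P) \<le> \<Lambda> * vol Q"
    and n\<^sub>0: "2 * \<Lambda> \<le> real n\<^sub>0" "0 < n\<^sub>0" and n\<^sub>1: "2 \<le> n\<^sub>1 * (v / q)"
begin

definition "band \<tau> = {Q \<in> S. \<tau> < avg Q \<and> avg Q \<le> 2 * \<tau>}"

lemma band: "finite (band \<tau>)" "band \<tau> \<subseteq> D"
  using S by (auto simp: band_def)

lemma measure_deep_band:
  assumes "0 < \<tau>" "0 \<le> \<beta>" "\<And>x. 0 < x \<Longrightarrow> exp (- x) \<le> c * x powr - \<beta>" "0 < n"
  shows "measure \<omega> (deep (band \<tau>) n) \<le> level_const (q / p) v \<beta> n\<^sub>0 n\<^sub>1 c * A * (2 / \<tau>) powr q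
    * (F / n) powr (q / p) * (A / n) powr \<beta>"
proof (rule measure_deep_level_decay[OF band assms(1) _ _ n\<^sub>1 _ n\<^sub>0 assms(2,3,4)])
  show "\<tau> * vol Q powr (v / q) \<le> mass Q" "mass Q \<le> 2 * \<tau> * vol Q powr (v / q)" if "Q \<in> band \<tau>" for Q
    using that S vol_pos[of Q] by (auto simp: band_def avg_def field_simps)
  show "(\<Sum>P\<in>{P \<in> band \<tau>. P \<subseteq> Q}. vol P) \<le> \<Lambda> * vol Q" if "Q \<in> band \<tau>" for Q
  proof -
    have "(\<Sum>P\<in>{P \<in> band \<tau>. P \<subseteq> Q}. vol P) \<le> (\<Sum>P\<in>{P \<in> S. P \<subseteq> Q}. vol P)"
      using S by (intro sum_mono2) (auto simp: band_def)
    also have "\<dots> \<le> \<Lambda> * vol Q"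
      using that by (intro packing) (simp add: band_def)
    finally show ?thesis .
  qed
qed

text \<open>A union bound over the occupied bands; the summable factor in \<open>K\<close> makes the
  total independent of their number.\<close>

lemma measure_superlevel_le:
  fixes t s \<epsilon> \<delta> K :: real
  assumes ts: "0 < t" "0 < s" and "0 < \<epsilon>" "0 < \<delta>"
  defines "m \<equiv> \<lambda>j::int. (1 - 2 powr - \<epsilon>) / 2 * 2 powr - (\<epsilon> * \<bar>real_of_int j\<bar>) * 4 powr real_of_int j / s\<^sup>2"
  assumes K: "\<And>j n. \<lbrakk>0 < n; m j \<le> real n\<rbrakk> \<Longrightarrow>
    measure \<omega> (deep (band (t * s * 2 powr (- real_of_int j - 1))) n) \<le> K * 2 powr - (\<delta> * \<bar>real_of_int j\<bar>)"
  shows "measure \<omega> {x. t\<^sup>2 < (\<Sum>Q\<in>S. (avg Q)\<^sup>2 * indicator Q x)} \<le> K * (2 / (1 - 2 powr - \<delta>))"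
proof -
  let ?\<tau> = "\<lambda>j::int. t * s * 2 powr (- real_of_int j - 1)"
  let ?n = "\<lambda>j. nat \<lfloor>m j\<rfloor> + 1"
  have "\<exists>J. finite J \<and> {x. t\<^sup>2 < (\<Sum>Q\<in>S. (avg Q)\<^sup>2 * indicator Q x)}
      \<subseteq> (\<Union>j\<in>J. {x. m j < real (overlap (band (?\<tau> j)) x)})"
    unfolding m_def band_def by (rule level_pigeonhole[OF S(1) avg_nonneg ts \<open>0 < \<epsilon>\<close>])
  then obtain J where J: "finite J" "{x. t\<^sup>2 < (\<Sum>Q\<in>S. (avg Q)\<^sup>2 * indicator Q x)}
      \<subseteq> (\<Union>j\<in>J. {x. m j < real (overlap (band (?\<tau> j)) x)})"
    by (elim exE conjE) (rule that; assumption)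
  have "2 powr - \<epsilon> < 2 powr (0::real)" using \<open>0 < \<epsilon>\<close> by (intro powr_less_mono) auto
  then have m: "0 \<le> m j" for j by (simp add: m_def)
  have deep: "{x. m j < real (overlap (band (?\<tau> j)) x)} = deep (band (?\<tau> j)) (?n j)" for j
    by (rule superlevel_overlap_eq_deep[OF m])
  have fm: "deep (band (?\<tau> j)) (?n j) \<in> fmeasurable \<omega>" for j
  proof -
    have "band (?\<tau> j) \<subseteq> fmeasurable \<omega>"
      using band(2) D_fmeasurable_\<omega> by blast
    from fmeasurable_deep[OF laminar_dyadic[OF D band] this] show ?thesis by simp
  qed
  have meas: "{x. t\<^sup>2 < (\<Sum>Q\<in>S. (avg Q)\<^sup>2 * indicator Q x)} \<in> sets \<omega>"
  proof -
    have [measurable]: "Q \<in> sets lebesgue" if "Q \<in> S" for Q using that S D_sets by auto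
    have "(\<lambda>x. \<Sum>Q\<in>S. (avg Q)\<^sup>2 * indicator Q x) \<in> borel_measurable lebesgue" by measurable
    then have "{x \<in> space lebesgue. t\<^sup>2 < (\<Sum>Q\<in>S. (avg Q)\<^sup>2 * indicator Q x)} \<in> sets lebesgue"
      by measurable
    then show ?thesis by simp
  qed
  have "measure \<omega> {x. t\<^sup>2 < (\<Sum>Q\<in>S. (avg Q)\<^sup>2 * indicator Q x)}
      \<le> measure \<omega> (\<Union>j\<in>J. deep (band (?\<tau> j)) (?n j))"
    using J(2) unfolding deep by (rule measure_mono_fmeasurable[OF _ meas fmeasurable.finite_UN[OF J(1) fm]])
  also have "\<dots> \<le> (\<Sum>j\<in>J. measure \<omega> (deep (band (?\<tau> j)) (?n j)))"
    by (rule measure_UNION_le[OF J(1) fmeasurableD[OF fm]])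
  also have "\<dots> \<le> (\<Sum>j\<in>J. K * 2 powr - (\<delta> * \<bar>real_of_int j\<bar>))"
  proof (intro sum_mono K)
    show "m j \<le> real (?n j)" for j using m[of j] by linarith
  qed simp
  also have "\<dots> = K * (\<Sum>j\<in>J. 2 powr - (\<delta> * \<bar>real_of_int j\<bar>))"
    by (simp add: sum_distrib_left)
  also have "\<dots> \<le> K * (2 / (1 - 2 powr - \<delta>))"
  proof (rule mult_left_mono[OF sum_powr_abs_int_le[OF \<open>0 < \<delta>\<close> J(1)]])
    \<comment> \<open>\<open>K\<close> is nonnegative because at \<open>j = 0\<close> it bounds a
      measure.\<close>
    have "0 \<le> K * 2 powr - (\<delta> * \<bar>real_of_int 0\<bar>)"
    proof (rule order_trans[OF measure_nonneg K[of "?n 0" 0]])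
      show "m 0 \<le> real (?n 0)" using m[of 0] by linarith
    qed simp
    then show "0 \<le> K" by simp
  qed
  finally show ?thesis .
qed

lemma two_div_scale_powr:
  fixes j :: int
  assumes "0 < t" "0 < s"
  shows "(2 / (t * s * 2 powr (- real_of_int j - 1))) powr q = 4 powr q * t powr - q * s powr - q * 2 powr (q * j)"
proof -
  have "2 / (t * s * 2 powr (- real_of_int j - 1)) = 4 * 2 powr j / (t * s)"
    by (simp add: powr_diff powr_minus field_simps)
  then show ?thesis
    by (simp add: powr_divide powr_mult powr_powr powr_minus field_simps)
qed

text \<open>On low levels, \<open>j \<ge> 0\<close>, the total decay order \<rho> in the count
  exceeds \<open>q / 2\<close> and beats the growth \<open>2 powr (q * j)\<close>. On high levels,
  \<open>j < 0\<close>, that factor decays by itself.\<close>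

lemma measure_superlevel_small_p:
  fixes \<beta> c t :: real
  assumes \<beta>: "0 \<le> \<beta>" "\<And>x. 0 < x \<Longrightarrow> exp (- x) \<le> c * x powr - \<beta>" and t: "0 < t"
  defines "\<rho> \<equiv> q / p + \<beta>"
  assumes \<rho>: "q < 2 * \<rho>"
  defines "\<kappa> \<equiv> (1 - 2 powr - ((2 * \<rho> - q) / (2 * \<rho>))) / 2" and "\<delta> \<equiv> min q (\<rho> - q / 2)"
  shows "measure \<omega> {x. t\<^sup>2 < (\<Sum>Q\<in>S. (avg Q)\<^sup>2 * indicator Q x)}
    \<le> level_const (q / p) v \<beta> n\<^sub>0 n\<^sub>1 c * 4 powr q * max 1 (\<kappa> powr - \<rho>) * (2 / (1 - 2 powr - \<delta>))
      * (A powr (1 + \<beta>) * F powr (q / p) * t powr - q)"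
proof -
  \<comment> \<open>Here \<epsilon> spends half of the surplus \<open>2 * \<rho> - q\<close>; the
    other half remains as decay in \<open>j\<close>.\<close>
  define \<epsilon> where "\<epsilon> = (2 * \<rho> - q) / (2 * \<rho>)"
  define L where "L = level_const (q / p) v \<beta> n\<^sub>0 n\<^sub>1 c"
  define B where "B = A powr (1 + \<beta>) * F powr (q / p) * t powr - q"
  have pos: "0 < \<rho>" "0 < \<epsilon>" "0 < \<delta>" using \<rho> p by (auto simp: \<epsilon>_def \<delta>_def)
  have \<epsilon>\<rho>: "\<epsilon> * \<rho> = \<rho> - q / 2" using pos(1) by (simp add: \<epsilon>_def field_simps)
  have "2 powr - \<epsilon> < 2 powr (0::real)" using pos by (intro powr_less_mono) auto
  then have \<kappa>: "0 < \<kappa>" by (simp add: \<kappa>_def \<epsilon>_def)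
  have "0 \<le> c * 1 powr - \<beta>" by (rule order_trans[OF _ \<beta>(2)]) auto
  then have L0: "0 \<le> L" using q_over_p by (simp add: L_def level_const_def)
  have B0: "0 \<le> B" by (simp add: B_def)
  have "measure \<omega> {x. t\<^sup>2 < (\<Sum>Q\<in>S. (avg Q)\<^sup>2 * indicator Q x)}
      \<le> (L * 4 powr q * max 1 (\<kappa> powr - \<rho>) * B) * (2 / (1 - 2 powr - \<delta>))"
  proof (rule measure_superlevel_le[OF t zero_less_one pos(2,3)])
    fix j :: int and n :: nat
    assume n: "0 < n"
      and "(1 - 2 powr - \<epsilon>) / 2 * 2 powr - (\<epsilon> * \<bar>real_of_int j\<bar>) * 4 powr real_of_int j / 1\<^sup>2 \<le> real n"
    then have mn: "\<kappa> * 2 powr - (\<epsilon> * \<bar>real_of_int j\<bar>) * 4 powr real_of_int j \<le> real n"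
      by (simp add: \<kappa>_def \<epsilon>_def)
    have geom: "2 powr (q * j) * real n powr - \<rho> \<le> max 1 (\<kappa> powr - \<rho>) * 2 powr - (\<delta> * \<bar>real_of_int j\<bar>)"
    proof (cases "0 \<le> j")
      case True
      have "2 powr (q * j) * real n powr - \<rho> \<le> \<kappa> powr - \<rho> * 2 powr ((q - 2 * \<rho>) * j + \<epsilon> * \<rho> * \<bar>real_of_int j\<bar>)"
        using pos \<kappa> mn by (intro powr_geometric_bound) auto
      also have "(q - 2 * \<rho>) * j + \<epsilon> * \<rho> * \<bar>real_of_int j\<bar> = - ((\<rho> - q / 2) * j)"
        using True unfolding \<epsilon>\<rho> by (simp add: algebra_simps)
      also have "\<kappa> powr - \<rho> * 2 powr - ((\<rho> - q / 2) * j) \<le> max 1 (\<kappa> powr - \<rho>) * 2 powr - (\<delta> * \<bar>real_of_int j\<bar>)"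
        using True by (intro mult_mono powr_mono) (auto simp: \<delta>_def intro!: mult_right_mono)
      finally show ?thesis .
    next
      \<comment> \<open>For negative \<open>j\<close> the threshold may be below 1, so only
        \<open>n \<ge> 1\<close> is used.\<close>
      case False
      have "real n powr - \<rho> \<le> 1 powr - \<rho>"
        using n pos by (intro powr_mono2') auto
      then have "2 powr (q * j) * real n powr - \<rho> \<le> 2 powr (q * j) * 1"
        by (intro mult_left_mono) auto
      also have "\<dots> \<le> 2 powr - (\<delta> * \<bar>real_of_int j\<bar>)"
        using False mult_right_mono[of \<delta> q "- real_of_int j"] by (auto simp: \<delta>_def)
      also have "\<dots> \<le> max 1 (\<kappa> powr - \<rho>) * 2 powr - (\<delta> * \<bar>real_of_int j\<bar>)"
        using mult_right_mono[of 1 "max 1 (\<kappa> powr - \<rho>)" "2 powr - (\<delta> * \<bar>real_of_int j\<bar>)"] by simp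
      finally show ?thesis .
    qed
    have "measure \<omega> (deep (band (t * 1 * 2 powr (- real_of_int j - 1))) n)
        \<le> L * A * (2 / (t * 1 * 2 powr (- real_of_int j - 1))) powr q * (F / n) powr (q / p) * (A / n) powr \<beta>"
      unfolding L_def using t n by (intro measure_deep_band \<beta>) auto
    also have "\<dots> = L * 4 powr q * B * (2 powr (q * j) * real n powr - \<rho>)"
    proof -
      have n\<rho>: "real n powr - \<rho> = 1 / (real n powr (q / p) * real n powr \<beta>)"
        by (simp only: \<rho>_def powr_minus_divide powr_add)
      have "(F / n) powr (q / p) * (A / n) powr \<beta> = F powr (q / p) * A powr \<beta> * real n powr - \<rho>"
        unfolding n\<rho> by (simp add: powr_divide)
      moreover have "A * A powr \<beta> = A powr (1 + \<beta>)"
        using A_ge_1 by (simp add: powr_add)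
      moreover have "L * A * (4 powr q * t powr - q * 1 powr - q * 2 powr (q * j)) * (F / n) powr (q / p) * (A / n) powr \<beta>
          = L * 4 powr q * t powr - q * 2 powr (q * j) * A * ((F / n) powr (q / p) * (A / n) powr \<beta>)"
        by simp
      moreover have "L * 4 powr q * t powr - q * 2 powr (q * j) * A * (F powr (q / p) * A powr \<beta> * real n powr - \<rho>)
          = L * 4 powr q * ((A * A powr \<beta>) * F powr (q / p) * t powr - q) * (2 powr (q * j) * real n powr - \<rho>)"
        by (simp only: mult_ac)
      ultimately show ?thesis
        unfolding two_div_scale_powr[OF t zero_less_one] B_def by presburger
    qed
    also have "\<dots> \<le> L * 4 powr q * B * (max 1 (\<kappa> powr - \<rho>) * 2 powr - (\<delta> * \<bar>real_of_int j\<bar>))"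
      using L0 B0 by (intro mult_left_mono geom) auto
    finally show "measure \<omega> (deep (band (t * 1 * 2 powr (- real_of_int j - 1))) n)
        \<le> L * 4 powr q * max 1 (\<kappa> powr - \<rho>) * B * 2 powr - (\<delta> * \<bar>real_of_int j\<bar>)"
      by (simp only: mult_ac)
  qed
  then show ?thesis by (simp only: L_def B_def mult_ac)
qed

text \<open>
  Rescaling the levels by \<open>s = A\<^sup>-\<^sup>1\<^sup>/\<^sup>2\<close> puts the level at which the overlap count reaches the threshold \<open>A\<close>,
  where geometric decay takes over from polynomial decay, at \<open>j = 0\<close>. The sum over the levels is
  then dominated by \<open>j = 0\<close> in both directions.
\<close>

lemma measure_superlevel_large_p:
  fixes c t :: real
  assumes p2: "2 < p" and c: "\<And>x. 0 < x \<Longrightarrow> exp (- x) \<le> c * x powr - q" and t: "0 < t"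
  defines "r \<equiv> q / p"
  defines "\<epsilon> \<equiv> min 1 ((q - 2 * r) / (2 * r))"
  defines "\<kappa> \<equiv> (1 - 2 powr - \<epsilon>) / 2" and "\<delta> \<equiv> min r ((q - 2 * r) / 2)"
  shows "measure \<omega> {x. t\<^sup>2 < (\<Sum>Q\<in>S. (avg Q)\<^sup>2 * indicator Q x)}
    \<le> max (level_const r v 0 n\<^sub>0 n\<^sub>1 1) (level_const r v q n\<^sub>0 n\<^sub>1 c) * 4 powr q
      * max (\<kappa> powr - r) (\<kappa> powr - (r + q)) * (2 / (1 - 2 powr - \<delta>))
      * (A powr (1 + q / 2 - r) * F powr r * t powr - q)"
proof -
  define L where "L = max (level_const r v 0 n\<^sub>0 n\<^sub>1 1) (level_const r v q n\<^sub>0 n\<^sub>1 c)"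
  define B where "B = A powr (1 + q / 2 - r) * F powr r * t powr - q"
  define M where "M = max (\<kappa> powr - r) (\<kappa> powr - (r + q))"
  define s where "s = A powr - (1 / 2)"
  have s: "0 < s" "s\<^sup>2 = 1 / A" "s powr - q = A powr (q / 2)"
    using A_ge_1 powr_add[of A "- (1 / 2)" "- (1 / 2)"]
    by (simp_all add: s_def powr_powr power2_eq_square powr_minus_divide[of A 1])
  have r: "1 < r" "2 * r < q" using q_over_p p2 p by (auto simp: r_def field_simps)
  have pos: "0 < \<epsilon>" "0 < \<delta>" using r by (auto simp: \<epsilon>_def \<delta>_def)
  \<comment> \<open>The two caps in \<epsilon> serve the two signs of \<open>j\<close>. For
    \<open>j < 0\<close> at most half of the margin \<open>q - 2 * r\<close> is spent; for
    \<open>j \<ge> 0\<close> the exponent \<open>q - 2 * (r + q) + \<epsilon> * (r + q)\<close>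
    stays at most \<open>- r\<close>.\<close>
  have \<epsilon>r: "\<epsilon> * r \<le> (q - 2 * r) / 2"
  proof -
    have "\<epsilon> * r \<le> (q - 2 * r) / (2 * r) * r"
      using r by (intro mult_right_mono) (auto simp: \<epsilon>_def)
    then show ?thesis using r by simp
  qed
  have \<epsilon>rq: "\<epsilon> * (r + q) \<le> r + q"
    using r p by (intro mult_left_le_one_le) (auto simp: \<epsilon>_def intro: less_imp_le)
  have "2 powr - \<epsilon> < 2 powr (0::real)" using pos by (intro powr_less_mono) auto
  then have \<kappa>: "0 < \<kappa>" by (simp add: \<kappa>_def)
  have L0: "0 \<le> L" using r by (auto simp: L_def level_const_def le_max_iff_disj)
  have B0: "0 \<le> B" by (simp add: B_def)
  have M0: "0 \<le> M" by (simp add: M_def le_max_iff_disj)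
  have "measure \<omega> {x. t\<^sup>2 < (\<Sum>Q\<in>S. (avg Q)\<^sup>2 * indicator Q x)}
      \<le> (L * 4 powr q * M * B) * (2 / (1 - 2 powr - \<delta>))"
  proof (rule measure_superlevel_le[OF t s(1) pos])
    fix j :: int and n :: nat
    assume n: "0 < n"
      and mn: "(1 - 2 powr - \<epsilon>) / 2 * 2 powr - (\<epsilon> * \<bar>real_of_int j\<bar>) * 4 powr real_of_int j / s\<^sup>2 \<le> real n"
    \<comment> \<open>For \<open>j < 0\<close> polynomial decay suffices, since
      \<open>q - 2 * r > 0\<close> makes \<open>2 powr ((q - 2 * r) * j)\<close> summable. For
      \<open>j \<ge> 0\<close> it does not, and the geometric decay enters as a power of order
      \<open>q\<close>.\<close>
    define \<beta> where "\<beta> = (if 0 \<le> j then q else 0)"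
    define c' where "c' = (if 0 \<le> j then c else 1)"
    have \<beta>: "0 \<le> \<beta>" using p by (simp add: \<beta>_def)
    have c': "exp (- x) \<le> c' * x powr - \<beta>" if "0 < x" for x
      using that c[of x] by (simp add: c'_def \<beta>_def)
    have L: "level_const r v \<beta> n\<^sub>0 n\<^sub>1 c' \<le> L"
      by (simp add: L_def \<beta>_def c'_def)
    \<comment> \<open>As \<open>s\<^sup>2 = 1 / A\<close>, the threshold bounds \<open>n / A\<close>
      from below, with no dependence on the weight.\<close>
    have x: "\<kappa> * 2 powr - (\<epsilon> * \<bar>real_of_int j\<bar>) * 4 powr real_of_int j \<le> real n / A"
      using mn A_ge_1 unfolding s(2) by (simp add: \<kappa>_def field_simps)
    have "2 powr (q * j) * (real n / A) powr - (r + \<beta>)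
        \<le> \<kappa> powr - (r + \<beta>) * 2 powr ((q - 2 * (r + \<beta>)) * j + \<epsilon> * (r + \<beta>) * \<bar>real_of_int j\<bar>)"
      using r \<beta> \<kappa> x by (intro powr_geometric_bound) auto
    also have "\<dots> \<le> M * 2 powr - (\<delta> * \<bar>real_of_int j\<bar>)"
    proof (intro mult_mono powr_mono)
      show "\<kappa> powr - (r + \<beta>) \<le> M" by (simp add: M_def \<beta>_def)
      show "(q - 2 * (r + \<beta>)) * j + \<epsilon> * (r + \<beta>) * \<bar>real_of_int j\<bar> \<le> - (\<delta> * \<bar>real_of_int j\<bar>)"
      proof (cases "0 \<le> j")
        case True
        have "(q - 2 * (r + \<beta>)) + \<epsilon> * (r + \<beta>) \<le> - \<delta>"
        proof -
          have \<beta>q: "\<beta> = q" using True by (simp add: \<beta>_def)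
          have "\<delta> \<le> r" by (simp add: \<delta>_def)
          then have "q - 2 * (r + q) + X \<le> - \<delta>" if "X \<le> r + q" for X
            using that by (simp add: algebra_simps)
          from this[OF \<epsilon>rq] show ?thesis unfolding \<beta>q .
        qed
        then have "((q - 2 * (r + \<beta>)) + \<epsilon> * (r + \<beta>)) * real_of_int j \<le> - \<delta> * real_of_int j"
          using True by (intro mult_right_mono) auto
        then show ?thesis using True by (simp add: distrib_right)
      next
        case False
        have "- (q - 2 * r) + \<epsilon> * r \<le> - \<delta>"
        proof -
          have "\<delta> \<le> (q - 2 * r) / 2" unfolding \<delta>_def by (rule min.cobounded2)
          then have "- (q - 2 * r) + X \<le> - \<delta>" if "X \<le> (q - 2 * r) / 2" for X
            using that by (simp add: field_simps)
          from this[OF \<epsilon>r] show ?thesis .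
        qed
        then have "(- (q - 2 * r) + \<epsilon> * r) * - real_of_int j \<le> - \<delta> * - real_of_int j"
          using False by (intro mult_right_mono) auto
        then show ?thesis using False by (simp add: \<beta>_def algebra_simps)
      qed
    qed (use M0 in auto)
    finally have geom: "2 powr (q * j) * (real n / A) powr - (r + \<beta>) \<le> M * 2 powr - (\<delta> * \<bar>real_of_int j\<bar>)" .
    have "measure \<omega> (deep (band (t * s * 2 powr (- real_of_int j - 1))) n)
        \<le> level_const r v \<beta> n\<^sub>0 n\<^sub>1 c' * A * (2 / (t * s * 2 powr (- real_of_int j - 1))) powr q * (F / n) powr r * (A / n) powr \<beta>"
      unfolding r_def using t s n by (intro measure_deep_band \<beta> c') auto
    also have "\<dots> \<le> L * A * (2 / (t * s * 2 powr (- real_of_int j - 1))) powr q * (F / n) powr r * (A / n) powr \<beta>"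
      using L A by (intro mult_right_mono) auto
    also have "\<dots> = L * 4 powr q * B * (2 powr (q * j) * (real n / A) powr - (r + \<beta>))"
    proof -
      have "(F / n) powr r * (A / n) powr \<beta> = F powr r * A powr - r * (real n / A) powr - (r + \<beta>)"
      proof -
        have "(real n / A) powr - (r + \<beta>) = A powr r * A powr \<beta> / (real n powr r * real n powr \<beta>)"
          by (simp only: powr_minus_divide powr_add powr_divide) simp
        then show ?thesis
          using A_ge_1 by (simp add: powr_divide powr_minus_divide)
      qed
      \<comment> \<open>The three factors come from the weight condition, from
        \<open>s powr - q\<close>, and from rewriting \<open>n powr - r\<close> in terms of
        \<open>n / A\<close>.\<close>
      moreover have "A * A powr (q / 2) * A powr - r = A powr (1 + q / 2 - r)"
        using A_ge_1 by (simp add: powr_add powr_diff powr_minus_divide)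
      moreover have "L * A * (4 powr q * t powr - q * A powr (q / 2) * 2 powr (q * j)) * (F / n) powr r * (A / n) powr \<beta>
          = L * 4 powr q * t powr - q * 2 powr (q * j) * (A * A powr (q / 2)) * ((F / n) powr r * (A / n) powr \<beta>)"
        by (simp only: mult_ac)
      moreover have "L * 4 powr q * t powr - q * 2 powr (q * j) * (A * A powr (q / 2))
            * (F powr r * A powr - r * (real n / A) powr - (r + \<beta>))
          = L * 4 powr q * ((A * A powr (q / 2) * A powr - r) * F powr r * t powr - q)
            * (2 powr (q * j) * (real n / A) powr - (r + \<beta>))"
        by (simp only: mult_ac)
      ultimately show ?thesis
        unfolding two_div_scale_powr[OF t s(1)] s(3) B_def by presburger
    qed
    also have "\<dots> \<le> L * 4 powr q * B * (M * 2 powr - (\<delta> * \<bar>real_of_int j\<bar>))"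
      using L0 B0 by (intro mult_left_mono geom) auto
    finally show "measure \<omega> (deep (band (t * s * 2 powr (- real_of_int j - 1))) n)
        \<le> L * 4 powr q * M * B * 2 powr - (\<delta> * \<bar>real_of_int j\<bar>)"
      by (simp only: mult_ac)
  qed
  then show ?thesis by (simp only: L_def B_def M_def mult_ac)
qed

end

end

section \<open>Weak type bounds\<close>

lemma epowr_mono: "x \<le> y \<Longrightarrow> 0 \<le> a \<Longrightarrow> epowr x a \<le> epowr y a"
  by (cases x; cases y) (auto simp: epowr_def top_unique intro!: ennreal_leI powr_mono2)

lemma epowr_ennreal: "0 \<le> x \<Longrightarrow> epowr (ennreal x) a = ennreal (x powr a)"
  by (simp add: epowr_def)

lemma weak_Lq_norm_le:
  assumes q: "0 < q" and K: "0 \<le> K"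
    and le: "\<And>t. 0 < t \<Longrightarrow> emeasure M {x \<in> space M. ennreal t < g x} \<le> ennreal (K * t powr - q)"
  shows "weak_Lq_norm M q g \<le> ennreal (K powr (1 / q))"
  unfolding weak_Lq_norm_def
proof (rule SUP_least)
  fix t :: real assume "t \<in> {0<..}"
  then have t: "0 < t" by simp
  have "ennreal t * epowr (emeasure M {x \<in> space M. ennreal t < g x}) (1 / q)
      \<le> ennreal t * epowr (ennreal (K * t powr - q)) (1 / q)"
    using le[OF t] q by (intro mult_left_mono epowr_mono) auto
  also have "\<dots> = ennreal (t * (K * t powr - q) powr (1 / q))"
    using t K by (simp add: epowr_ennreal flip: ennreal_mult')
  also have "t * (K * t powr - q) powr (1 / q) = K powr (1 / q)"
  proof -
    have "(t powr - q) powr (1 / q) = t powr - 1"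
      using q by (simp add: powr_powr)
    then have "(t powr - q) powr (1 / q) = 1 / t"
      using t powr_minus_divide[of t 1] by simp
    then show ?thesis using t by (simp only: powr_mult) simp
  qed
  finally show "ennreal t * epowr (emeasure M {x \<in> space M. ennreal t < g x}) (1 / q) \<le> ennreal (K powr (1 / q))" .
qed

context Apq_weight_function begin

lemma frac_avg_eq: "Q \<in> D \<Longrightarrow> frac_avg \<alpha> Q f = ennreal (avg Q)"
  using mass_Holder(1)[OF _ D_sets, of Q Q] vol_pos[of Q] p
  by (simp add: frac_avg_def avg_def v_def divide_ennreal)

text \<open>The infinite sum is the supremum of its finite partial sums, so the superlevel set is
  covered by an increasing sequence of those of finite subcollections. Continuity from below carries
  over the uniform bound.\<close>

lemma superlevel_sparse_op_le:
  assumes S: "S \<subseteq> D" and t: "0 < t" and K: "0 \<le> K"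
    and le: "\<And>S'. finite S' \<Longrightarrow> S' \<subseteq> S \<Longrightarrow> measure \<omega> {x. t\<^sup>2 < (\<Sum>Q\<in>S'. (avg Q)\<^sup>2 * indicator Q x)} \<le> K"
  shows "emeasure \<omega> {x \<in> space \<omega>. ennreal t < sparse_op \<alpha> S f x} \<le> ennreal K"
proof -
  define B where "B = (\<lambda>S'. {x. t\<^sup>2 < (\<Sum>Q\<in>S'. (avg Q)\<^sup>2 * indicator Q x)})"
  define Sn where "Sn = (\<lambda>n. {Q \<in> S. to_nat_on S Q < n})"
  have S_count: "countable S"
    using countable_subset[OF S countable_dyadic_grid[OF D]] .
  have Sn: "finite (Sn n)" "Sn n \<subseteq> S" for n
  proof -
    have "inj_on (to_nat_on S) (Sn n)"
      using inj_on_to_nat_on[OF S_count] by (rule inj_on_subset) (auto simp: Sn_def)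
    moreover have "to_nat_on S ` Sn n \<subseteq> {..<n}" by (auto simp: Sn_def)
    ultimately show "finite (Sn n)" by (meson finite_lessThan inj_on_finite)
  qed (auto simp: Sn_def)
  have B_sets: "B S' \<in> sets \<omega>" if "finite S'" "S' \<subseteq> S" for S'
  proof -
    have [measurable]: "Q \<in> sets lebesgue" if "Q \<in> S'" for Q using that \<open>S' \<subseteq> S\<close> S D_sets by auto
    have "(\<lambda>x. \<Sum>Q\<in>S'. (avg Q)\<^sup>2 * indicator Q x) \<in> borel_measurable lebesgue" by measurable
    then have "{x \<in> space lebesgue. t\<^sup>2 < (\<Sum>Q\<in>S'. (avg Q)\<^sup>2 * indicator Q x)} \<in> sets lebesgue"
      by measurable
    then show ?thesis by (simp add: B_def)
  qed
  have B_mono: "B S' \<subseteq> B S''" if "S' \<subseteq> S''" "finite S''" for S' S''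
  proof
    fix x assume "x \<in> B S'"
    then have "t\<^sup>2 < (\<Sum>Q\<in>S'. (avg Q)\<^sup>2 * indicator Q x)" by (simp add: B_def)
    also have "\<dots> \<le> (\<Sum>Q\<in>S''. (avg Q)\<^sup>2 * indicator Q x)"
      using that by (intro sum_mono2) auto
    finally show "x \<in> B S''" by (simp add: B_def)
  qed
  have B_emeasure: "emeasure \<omega> (B (Sn n)) \<le> ennreal K" for n
  proof -
    \<comment> \<open>This inclusion gives finite measure, without which a bound on
      \<open>measure\<close> says nothing about \<open>emeasure\<close>.\<close>
    have sub: "B (Sn n) \<subseteq> \<Union>(Sn n)"
    proof
      fix x assume "x \<in> B (Sn n)"
      then have "(\<Sum>Q\<in>Sn n. (avg Q)\<^sup>2 * indicator Q x) \<noteq> 0"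
        using zero_le_power2[of t] by (auto simp: B_def)
      then obtain Q where "Q \<in> Sn n" "(avg Q)\<^sup>2 * indicator Q x \<noteq> 0"
        by (rule sum.not_neutral_contains_not_neutral)
      then show "x \<in> \<Union>(Sn n)" by (auto simp: indicator_def split: if_splits)
    qed
    have "\<Union>(Sn n) \<in> fmeasurable \<omega>"
      using Sn S D_fmeasurable_\<omega> by (intro fmeasurable.finite_Union) blast+
    then have "B (Sn n) \<in> fmeasurable \<omega>"
      by (rule fmeasurableI2[OF _ sub B_sets[OF Sn]])
    then have "emeasure \<omega> (B (Sn n)) = ennreal (measure \<omega> (B (Sn n)))"
      by (rule emeasure_eq_measure2)
    also have "\<dots> \<le> ennreal K"
      unfolding B_def by (intro ennreal_leI le Sn)
    finally show ?thesis .
  qed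
  have "{x \<in> space \<omega>. ennreal t < sparse_op \<alpha> S f x} \<subseteq> (\<Union>n. B (Sn n))"
  proof
    fix x assume "x \<in> {x \<in> space \<omega>. ennreal t < sparse_op \<alpha> S f x}"
    then have x: "ennreal t < sparse_op \<alpha> S f x" by simp
    let ?y = "\<Sum>\<^sub>\<infinity>Q\<in>S. (frac_avg \<alpha> Q f)\<^sup>2 * indicator Q x"
    have "ennreal (t\<^sup>2) < ?y"
    proof (rule ccontr)
      assume "\<not> ennreal (t\<^sup>2) < ?y"
      then have "sparse_op \<alpha> S f x \<le> epowr (ennreal (t\<^sup>2)) (1 / 2)"
        unfolding sparse_op_def by (intro epowr_mono) auto
      also have "\<dots> = ennreal t"
        using t by (simp add: epowr_ennreal powr_half_sqrt)
      finally show False using x by simp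
    qed
    also have "?y = (SUP S'\<in>{S'. finite S' \<and> S' \<subseteq> S}. \<Sum>Q\<in>S'. (frac_avg \<alpha> Q f)\<^sup>2 * indicator Q x)"
      by (rule nonneg_infsum_complete) simp
    finally obtain S' where S': "finite S'" "S' \<subseteq> S" "ennreal (t\<^sup>2) < (\<Sum>Q\<in>S'. (frac_avg \<alpha> Q f)\<^sup>2 * indicator Q x)"
      by (auto simp: less_SUP_iff)
    have "(\<Sum>Q\<in>S'. (frac_avg \<alpha> Q f)\<^sup>2 * indicator Q x) = (\<Sum>Q\<in>S'. ennreal ((avg Q)\<^sup>2 * indicator Q x))"
    proof (rule sum.cong[OF refl])
      fix Q assume "Q \<in> S'"
      then have "frac_avg \<alpha> Q f = ennreal (avg Q)" using S' S by (intro frac_avg_eq) auto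
      then show "(frac_avg \<alpha> Q f)\<^sup>2 * indicator Q x = ennreal ((avg Q)\<^sup>2 * indicator Q x)"
        using avg_nonneg[of Q] by (auto simp: indicator_def ennreal_power)
    qed
    also have "\<dots> = ennreal (\<Sum>Q\<in>S'. (avg Q)\<^sup>2 * indicator Q x)"
      by (rule sum_ennreal) simp
    finally have "x \<in> B S'"
      using S'(3) by (simp add: B_def ennreal_less_iff)
    moreover obtain n where "S' \<subseteq> Sn n"
    proof
      show "S' \<subseteq> Sn (Suc (Max (to_nat_on S ` S')))"
        using S' by (auto simp: Sn_def less_Suc_eq_le)
    qed
    ultimately show "x \<in> (\<Union>n. B (Sn n))"
      using B_mono[of S' "Sn n"] Sn(1)[of n] by auto
  qed
  then have "emeasure \<omega> {x \<in> space \<omega>. ennreal t < sparse_op \<alpha> S f x} \<le> emeasure \<omega> (\<Union>n. B (Sn n))"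
    using B_sets[OF Sn] by (intro emeasure_mono sets.countable_UN) auto
  also have "\<dots> = (SUP n. emeasure \<omega> (B (Sn n)))"
  proof (rule SUP_emeasure_incseq[symmetric])
    have "Sn i \<subseteq> Sn j" if "i \<le> j" for i j using that by (auto simp: Sn_def)
    then show "incseq (\<lambda>n. B (Sn n))"
      using B_mono Sn(1) by (simp add: incseq_def)
  qed (use B_sets[OF Sn] in auto)
  also have "\<dots> \<le> ennreal K"
    by (rule SUP_least[OF B_emeasure])
  finally show ?thesis .
qed

lemma weak_Lq_norm_sparse_op_le:
  assumes "S \<subseteq> D" "0 \<le> K"
    and le: "\<And>S' t. \<lbrakk>finite S'; S' \<subseteq> S; 0 < t\<rbrakk> \<Longrightarrow>
      measure \<omega> {x. t\<^sup>2 < (\<Sum>Q\<in>S'. (avg Q)\<^sup>2 * indicator Q x)} \<le> K * (A powr e * F powr (q / p) * t powr - q)"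
  shows "weak_Lq_norm \<omega> q (sparse_op \<alpha> S f) \<le> ennreal (K powr (1 / q) * A powr (e / q)) * ennreal (F powr (1 / p))"
proof -
  have "weak_Lq_norm \<omega> q (sparse_op \<alpha> S f) \<le> ennreal ((K * A powr e * F powr (q / p)) powr (1 / q))"
  proof (rule weak_Lq_norm_le)
    show "emeasure \<omega> {x \<in> space \<omega>. ennreal t < sparse_op \<alpha> S f x} \<le> ennreal (K * A powr e * F powr (q / p) * t powr - q)"
      if "0 < t" for t
      using assms(1,2) le that by (intro superlevel_sparse_op_le) (auto simp: mult.assoc)
  qed (use p assms(2) in auto)
  also have "(K * A powr e * F powr (q / p)) powr (1 / q) = K powr (1 / q) * A powr (e / q) * F powr (1 / p)"
    using p by (simp add: powr_mult powr_powr)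
  finally show ?thesis by (simp add: ennreal_mult')
qed

end

section \<open>Operator norm bounds with uniform constants\<close>

context Apq_weight begin

lemma sparse_op_norm_le:
  assumes "S \<subseteq> D" "0 \<le> K"
    and le: "\<And>f S' t. \<lbrakk>Apq_weight_function D w \<alpha> p q A f; finite S'; S' \<subseteq> S; 0 < t\<rbrakk> \<Longrightarrow>
      measure \<omega> {x. t\<^sup>2 < (\<Sum>Q\<in>S'. (Apq_weight_function.avg \<alpha> q f Q)\<^sup>2 * indicator Q x)}
        \<le> K * (A powr e * measure (Fm f) UNIV powr (q / p) * t powr - q)"
  shows "sparse_op_norm \<alpha> S w p q \<le> ennreal (K powr (1 / q)) * epowr (Apq_const D p q w) (e / q)"
proof -
  have "ennreal (K powr (1 / q) * A powr (e / q)) \<in> {C. \<forall>f. f \<in> borel_measurable lebesgue \<longrightarrow> (\<forall>x. 0 \<le> f x) \<longrightarrow>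
      Lp_norm (pow_measure w p) p f < \<infinity> \<longrightarrow>
      weak_Lq_norm (pow_measure w q) q (sparse_op \<alpha> S f) \<le> C * Lp_norm (pow_measure w p) p f}"
  proof (intro CollectI allI impI)
    fix f :: "real ^ 'd \<Rightarrow> real"
    assume f [measurable]: "f \<in> borel_measurable lebesgue" and f0: "\<forall>x. 0 \<le> f x"
      and fin: "Lp_norm (pow_measure w p) p f < \<infinity>"
    have "(\<integral>\<^sup>+x. ennreal (\<bar>f x\<bar> powr p) \<partial>pow_measure w p) = emeasure (Fm f) UNIV"
      unfolding pow_measure_def Fm_def using f0
      by (subst nn_integral_density, measurable, subst emeasure_density)
        (auto intro!: nn_integral_cong simp: ennreal_mult' mult.commute)
    then have norm: "Lp_norm (pow_measure w p) p f = epowr (emeasure (Fm f) UNIV) (1 / p)"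
      by (simp add: Lp_norm_def)
    then have F_fin: "emeasure (Fm f) UNIV < \<infinity>"
      using fin by (cases "emeasure (Fm f) UNIV = \<infinity>") (auto simp: epowr_def less_top infinity_ennreal_def)
    interpret Apq_weight_function D w \<alpha> p q A f
      using f f0 F_fin by unfold_locales auto
    have "Lp_norm (pow_measure w p) p f = ennreal (measure (Fm f) UNIV powr (1 / p))"
      unfolding norm using F_fin by (simp add: epowr_ennreal emeasure_eq_ennreal_measure less_top)
    then show "weak_Lq_norm \<omega> q (sparse_op \<alpha> S f)
        \<le> ennreal (K powr (1 / q) * A powr (e / q)) * Lp_norm (pow_measure w p) p f"
      using weak_Lq_norm_sparse_op_le[OF assms(1,2) le[OF Apq_weight_function_axioms]] by simp
  qed
  then have "sparse_op_norm \<alpha> S w p q \<le> ennreal (K powr (1 / q) * A powr (e / q))"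
    unfolding sparse_op_norm_def by (rule Inf_lower)
  then show ?thesis
    using A by (simp add: epowr_ennreal ennreal_mult')
qed

end

text \<open>\<open>K\<close> is fixed before the grid, the collection, the weight and the function,
  so the resulting constant depends on none of them.\<close>

lemma sparse_op_norm_bound:
  fixes \<alpha> p q \<gamma> e K :: real
  assumes params: "0 < \<alpha>" "\<alpha> < real CARD('d::finite)" "1 < p" "p \<le> q" "1 / q + \<alpha> / real CARD('d) = 1 / p" "0 < \<gamma>"
    and K: "0 \<le> K"
    and le: "\<And>(D :: (real ^ 'd) set set) w A f S t. \<lbrakk>Apq_weight_function D w \<alpha> p q A f; finite S; S \<subseteq> D;
      \<And>Q. Q \<in> S \<Longrightarrow> (\<Sum>P\<in>{P \<in> S. P \<subseteq> Q}. measure lebesgue P) \<le> 1 / \<gamma> * measure lebesgue Q; 0 < t\<rbrakk> \<Longrightarrow>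
      measure (pow_measure w q) {x. t\<^sup>2 < (\<Sum>Q\<in>S. (Apq_weight_function.avg \<alpha> q f Q)\<^sup>2 * indicator Q x)}
        \<le> K * (A powr e * measure (Apq_weight.Fm w p f) UNIV powr (q / p) * t powr - q)"
  shows "\<exists>C>0. \<forall>(D :: (real ^ 'd) set set) S w.
    dyadic_grid D \<longrightarrow> S \<subseteq> D \<longrightarrow> sparse_collection \<gamma> S \<longrightarrow> weight w \<longrightarrow>
      sparse_op_norm \<alpha> S w p q \<le> ennreal C * epowr (Apq_const D p q w) (e / q)"
\<comment> \<open>Adding 1 keeps the constant positive even if \<open>K = 0\<close>, so that the
  right side is infinite whenever the weight constant is.\<close>
proof (intro exI[of _ "K powr (1 / q) + 1"] conjI allI impI)
  show "0 < K powr (1 / q) + 1" by (simp add: add_nonneg_pos)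
  fix D S :: "(real ^ 'd) set set" and w :: "real ^ 'd \<Rightarrow> real"
  assume D: "dyadic_grid D" and S: "S \<subseteq> D" "sparse_collection \<gamma> S" and w: "weight w"
  show "sparse_op_norm \<alpha> S w p q \<le> ennreal (K powr (1 / q) + 1) * epowr (Apq_const D p q w) (e / q)"
  proof (cases "Apq_const D p q w = \<infinity>")
    case True
    have "0 < K powr (1 / q) + 1" by (simp add: add_nonneg_pos)
    then show ?thesis by (simp add: True epowr_def ennreal_mult_top)
  next
    case False
    then interpret Apq_weight D w \<alpha> p q "enn2real (Apq_const D p q w)"
      using D w params by unfold_locales (auto simp: less_top)
    have "sparse_op_norm \<alpha> S w p q \<le> ennreal (K powr (1 / q)) * epowr (Apq_const D p q w) (e / q)"
    proof (rule sparse_op_norm_le[OF S(1) K])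
      fix f S' and t :: real
      assume *: "Apq_weight_function D w \<alpha> p q (enn2real (Apq_const D p q w)) f" "finite S'" "S' \<subseteq> S" "0 < t"
      have "(\<Sum>P\<in>{P \<in> S'. P \<subseteq> Q}. measure lebesgue P) \<le> 1 / \<gamma> * measure lebesgue Q" if "Q \<in> S'" for Q
        using that *(3) S(1) by (intro sparse_packing[OF D \<open>0 < \<gamma>\<close> S(2) *(3,2) S(1)]) auto
      from le[OF *(1,2) subset_trans[OF *(3) S(1)] this *(4)]
      show "measure \<omega> {x. t\<^sup>2 < (\<Sum>Q\<in>S'. (Apq_weight_function.avg \<alpha> q f Q)\<^sup>2 * indicator Q x)}
          \<le> K * (enn2real (Apq_const D p q w) powr e * measure (Fm f) UNIV powr (q / p) * t powr - q)"
        by simp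
    qed
    also have "\<dots> \<le> ennreal (K powr (1 / q) + 1) * epowr (Apq_const D p q w) (e / q)"
      by (intro mult_right_mono ennreal_leI) auto
    finally show ?thesis .
  qed
qed

lemma level_const_nonneg: "1 < r \<Longrightarrow> 0 \<le> c \<Longrightarrow> 0 \<le> level_const r v \<beta> n\<^sub>0 n\<^sub>1 c"
  by (simp add: level_const_def)

context
  fixes \<alpha> p q \<gamma> :: real
  assumes params: "0 < \<alpha>" "\<alpha> < real CARD('d::finite)" "1 < p" "p \<le> q" "1 / q + \<alpha> / real CARD('d) = 1 / p" "0 < \<gamma>"
begin

text \<open>These fix the block lengths of the geometric and the polynomial decay in terms of
  \<gamma>, \<alpha>, \<open>q\<close> and the dimension alone.\<close>

lemma exists_generations:
  "\<exists>n\<^sub>0. 2 * (1 / \<gamma>) \<le> real n\<^sub>0 \<and> 0 < n\<^sub>0"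
  "\<exists>n\<^sub>1. 2 \<le> real n\<^sub>1 * (q * (1 - \<alpha> / real CARD('d)) / q)"
proof -
  obtain n\<^sub>0 where "2 * (1 / \<gamma>) \<le> real n\<^sub>0" using real_arch_simple by blast
  then show "\<exists>n\<^sub>0. 2 * (1 / \<gamma>) \<le> real n\<^sub>0 \<and> 0 < n\<^sub>0"
    using params(6) by (intro exI[of _ n\<^sub>0]) (auto intro!: gr0I)
  have "0 < q * (1 - \<alpha> / real CARD('d)) / q"
    using params by simp
  then obtain n\<^sub>1 where "2 < real n\<^sub>1 * (q * (1 - \<alpha> / real CARD('d)) / q)"
    using reals_Archimedean3 by blast
  then show "\<exists>n\<^sub>1. 2 \<le> real n\<^sub>1 * (q * (1 - \<alpha> / real CARD('d)) / q)"
    by (intro exI[of _ n\<^sub>1]) auto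
qed

lemma q_over_p_gt_1: "1 < q / p"
  using one_less_exponent_quotient[OF _ _ _ _ params(5)] params by simp

text \<open>The free \<beta> serves two ranges: a larger \<beta> makes the sum over the levels
  converge for larger \<open>q\<close>, at the price of a higher power of the weight
  constant.\<close>

lemma sparse_op_norm_small_p:
  assumes \<beta>: "0 \<le> \<beta>" "q < 2 * (q / p + \<beta>)"
  shows "\<exists>C>0. \<forall>(D :: (real ^ 'd) set set) S w.
    dyadic_grid D \<longrightarrow> S \<subseteq> D \<longrightarrow> sparse_collection \<gamma> S \<longrightarrow> weight w \<longrightarrow>
      sparse_op_norm \<alpha> S w p q \<le> ennreal C * epowr (Apq_const D p q w) ((1 + \<beta>) / q)"
proof -
  define \<nu> where "\<nu> = q * (1 - \<alpha> / real CARD('d))"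
  define \<rho> where "\<rho> = q / p + \<beta>"
  define \<kappa> where "\<kappa> = (1 - 2 powr - ((2 * \<rho> - q) / (2 * \<rho>))) / 2"
  define \<delta> where "\<delta> = min q (\<rho> - q / 2)"
  obtain n\<^sub>0 n\<^sub>1 where n: "2 * (1 / \<gamma>) \<le> real n\<^sub>0" "0 < n\<^sub>0" "2 \<le> real n\<^sub>1 * (\<nu> / q)"
    using exists_generations unfolding \<nu>_def by blast
  obtain c where c: "0 < c" "\<And>x. 0 < x \<Longrightarrow> exp (- x) \<le> c * x powr - \<beta>"
    using exp_minus_le_powr[OF \<beta>(1)] by blast
  define K where "K = level_const (q / p) \<nu> \<beta> n\<^sub>0 n\<^sub>1 c * 4 powr q * max 1 (\<kappa> powr - \<rho>) * (2 / (1 - 2 powr - \<delta>))"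
  have "q < 2 * \<rho>" using \<beta>(2) by (simp only: \<rho>_def)
  then have "0 < \<delta>" using params by (auto simp: \<delta>_def)
  then have "2 powr - \<delta> < 2 powr (0::real)" by (intro powr_less_mono) auto
  then have K: "0 \<le> K"
    unfolding K_def using c(1) q_over_p_gt_1 by (intro mult_nonneg_nonneg level_const_nonneg) auto
  show ?thesis
  proof (rule sparse_op_norm_bound[OF params K])
    fix D S :: "(real ^ 'd) set set" and w :: "real ^ 'd \<Rightarrow> real" and A t :: real and f
    assume f: "Apq_weight_function D w \<alpha> p q A f" and S: "finite S" "S \<subseteq> D"
      "\<And>Q. Q \<in> S \<Longrightarrow> (\<Sum>P\<in>{P \<in> S. P \<subseteq> Q}. measure lebesgue P) \<le> 1 / \<gamma> * measure lebesgue Q" and t: "0 < t"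
    interpret Apq_weight_function D w \<alpha> p q A f by (rule f)
    have v: "v = \<nu>" by (simp add: v_def \<nu>_def)
    show "measure \<omega> {x. t\<^sup>2 < (\<Sum>Q\<in>S. (avg Q)\<^sup>2 * indicator Q x)}
        \<le> K * (A powr (1 + \<beta>) * F powr (q / p) * t powr - q)"
      unfolding K_def \<delta>_def \<kappa>_def \<rho>_def v[symmetric]
      by (rule measure_superlevel_small_p[OF S n(1,2) n(3)[folded v] \<beta>(1) c(2) t \<beta>(2)])
  qed
qed

lemma sparse_op_norm_large_p:
  assumes p2: "2 < p"
  shows "\<exists>C>0. \<forall>(D :: (real ^ 'd) set set) S w.
    dyadic_grid D \<longrightarrow> S \<subseteq> D \<longrightarrow> sparse_collection \<gamma> S \<longrightarrow> weight w \<longrightarrow>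
      sparse_op_norm \<alpha> S w p q \<le> ennreal C * epowr (Apq_const D p q w) ((1 + q / 2 - q / p) / q)"
proof -
  define \<nu> where "\<nu> = q * (1 - \<alpha> / real CARD('d))"
  define r where "r = q / p"
  define \<kappa> where "\<kappa> = (1 - 2 powr - (min 1 ((q - 2 * r) / (2 * r)))) / 2"
  define \<delta> where "\<delta> = min r ((q - 2 * r) / 2)"
  obtain n\<^sub>0 n\<^sub>1 where n: "2 * (1 / \<gamma>) \<le> real n\<^sub>0" "0 < n\<^sub>0" "2 \<le> real n\<^sub>1 * (\<nu> / q)"
    using exists_generations unfolding \<nu>_def by blast
  have "0 \<le> q" using params by simp
  then obtain c where c: "0 < c" "\<And>x. 0 < x \<Longrightarrow> exp (- x) \<le> c * x powr - q"
    using exp_minus_le_powr by blast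
  define K where "K = max (level_const r \<nu> 0 n\<^sub>0 n\<^sub>1 1) (level_const r \<nu> q n\<^sub>0 n\<^sub>1 c) * 4 powr q
      * max (\<kappa> powr - r) (\<kappa> powr - (r + q)) * (2 / (1 - 2 powr - \<delta>))"
  have r: "1 < r" "2 * r < q" using q_over_p_gt_1 p2 params by (auto simp: r_def field_simps)
  then have "0 < \<delta>" by (auto simp: \<delta>_def)
  then have "2 powr - \<delta> < 2 powr (0::real)" by (intro powr_less_mono) auto
  then have K: "0 \<le> K"
    unfolding K_def using c(1) r level_const_nonneg[of r 1]
    by (intro mult_nonneg_nonneg) (auto simp: le_max_iff_disj)
  show ?thesis
  proof (rule sparse_op_norm_bound[OF params K])
    fix D S :: "(real ^ 'd) set set" and w :: "real ^ 'd \<Rightarrow> real" and A t :: real and f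
    assume f: "Apq_weight_function D w \<alpha> p q A f" and S: "finite S" "S \<subseteq> D"
      "\<And>Q. Q \<in> S \<Longrightarrow> (\<Sum>P\<in>{P \<in> S. P \<subseteq> Q}. measure lebesgue P) \<le> 1 / \<gamma> * measure lebesgue Q" and t: "0 < t"
    interpret Apq_weight_function D w \<alpha> p q A f by (rule f)
    have v: "v = \<nu>" by (simp add: v_def \<nu>_def)
    show "measure \<omega> {x. t\<^sup>2 < (\<Sum>Q\<in>S. (avg Q)\<^sup>2 * indicator Q x)}
        \<le> K * (A powr (1 + q / 2 - q / p) * F powr (q / p) * t powr - q)"
      unfolding K_def \<delta>_def \<kappa>_def r_def v[symmetric]
      by (rule measure_superlevel_large_p[OF S n(1,2) n(3)[folded v] p2 c(2) t])
  qed
qed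

end

theorem corollary4p2:
  fixes \<alpha> p q \<gamma> :: real
  assumes "0 < \<alpha>" "\<alpha> < real CARD('d::finite)"
    and "1 < p" "p \<le> q"
    and "1 / q + \<alpha> / real CARD('d) = 1 / p"
    and "0 < \<gamma>" "\<gamma> < 1"
  shows "\<exists>C>0. \<forall>(D :: (real ^ 'd) set set) S w.
    dyadic_grid D \<longrightarrow> S \<subseteq> D \<longrightarrow> sparse_collection \<gamma> S \<longrightarrow> weight w \<longrightarrow>
      (2 \<le> q \<and> ereal q \<le> q_threshold \<alpha> CARD('d) \<longrightarrow>
         sparse_op_norm \<alpha> S w p q
           \<le> ennreal C * epowr (Apq_const D p q w) (conj_exp p / q * (1 - \<alpha> / real CARD('d)))) \<and>
      (q_threshold \<alpha> CARD('d) < ereal q \<longrightarrow>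
         sparse_op_norm \<alpha> S w p q
           \<le> ennreal C * epowr (Apq_const D p q w) (1 / 2 - \<alpha> / real CARD('d))) \<and>
      (1 \<le> q \<and> q < 2 \<longrightarrow>
         sparse_op_norm \<alpha> S w p q
           \<le> ennreal C * epowr (Apq_const D p q w) (1 / q))"
proof -
  note params = assms(1-6)
  have \<alpha>d: "\<alpha> / real CARD('d) = 1 / p - 1 / q"
    using assms(5) by linarith
  have pos: "0 < p" "0 < q" using assms by auto
  \<comment> \<open>With \<open>\<alpha> / d = 1 / p - 1 / q\<close> the condition becomes
    \<open>q * (1 - 2 / p) \<le> 0\<close>.\<close>
  have threshold: "ereal q \<le> q_threshold \<alpha> CARD('d) \<longleftrightarrow> p \<le> 2"
  proof -
    have "ereal q \<le> q_threshold \<alpha> CARD('d) \<longleftrightarrow> q * (1 - 2 * (\<alpha> / real CARD('d))) \<le> 2"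
    proof (cases "2 * \<alpha> < real CARD('d)")
      case True
      then have "0 < 1 - 2 * (\<alpha> / real CARD('d))" by (simp add: field_simps)
      then show ?thesis using True by (simp add: q_threshold_def pos_le_divide_eq)
    next
      case False
      then have "1 - 2 * (\<alpha> / real CARD('d)) \<le> 0" by (simp add: field_simps)
      then have "q * (1 - 2 * (\<alpha> / real CARD('d))) \<le> 0"
        using pos by (simp add: mult_nonneg_nonpos)
      then show ?thesis using False by (simp add: q_threshold_def)
    qed
    also have "\<dots> \<longleftrightarrow> p \<le> 2"
      unfolding \<alpha>d using pos by (simp add: field_simps)
    finally show ?thesis .
  qed
  let ?P = "\<lambda>C e. \<forall>(D :: (real ^ 'd) set set) S w.
    dyadic_grid D \<longrightarrow> S \<subseteq> D \<longrightarrow> sparse_collection \<gamma> S \<longrightarrow> weight w \<longrightarrow>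
      sparse_op_norm \<alpha> S w p q \<le> ennreal C * epowr (Apq_const D p q w) e"
  have mono: "?P C' e" if "?P C e" "C \<le> C'" for C C' e
  proof (intro allI impI)
    fix D S :: "(real ^ 'd) set set" and w :: "real ^ 'd \<Rightarrow> real"
    assume "dyadic_grid D" "S \<subseteq> D" "sparse_collection \<gamma> S" "weight w"
    then have "sparse_op_norm \<alpha> S w p q \<le> ennreal C * epowr (Apq_const D p q w) e"
      using that(1) by blast
    also have "\<dots> \<le> ennreal C' * epowr (Apq_const D p q w) e"
      using that(2) by (intro mult_right_mono ennreal_leI) auto
    finally show "sparse_op_norm \<alpha> S w p q \<le> ennreal C' * epowr (Apq_const D p q w) e" .
  qed
  have "\<exists>C>0. p \<le> 2 \<longrightarrow> ?P C (conj_exp p / q * (1 - \<alpha> / real CARD('d)))"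
  proof (cases "p \<le> 2")
    case True
    \<comment> \<open>This \<beta> gives the exponent in the claim because
      \<open>1 - \<alpha> / d = 1 / p' + 1 / q\<close>. Its positivity provides the strict
      inequality needed when \<open>p = 2\<close>.\<close>
    define \<beta> where "\<beta> = conj_exp p / q"
    have "0 < \<beta>" using assms pos by (simp add: \<beta>_def conj_exp_def)
    moreover have "q \<le> 2 * (q / p)" using True pos by (simp add: field_simps)
    moreover have "(1 + \<beta>) / q = conj_exp p / q * (1 - \<alpha> / real CARD('d))"
      unfolding \<alpha>d \<beta>_def conj_exp_def using assms pos by (simp add: field_simps)
    ultimately show ?thesis
      using sparse_op_norm_small_p[OF params, of \<beta>] by auto
  qed (auto intro: exI[of _ 1])
  moreover have "\<exists>C>0. 2 < p \<longrightarrow> ?P C (1 / 2 - \<alpha> / real CARD('d))"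
  proof (cases "2 < p")
    case True
    have "(1 + q / 2 - q / p) / q = 1 / 2 - \<alpha> / real CARD('d)"
      unfolding \<alpha>d using pos by (simp add: field_simps)
    then show ?thesis
      using sparse_op_norm_large_p[OF params True] by auto
  qed (auto intro: exI[of _ 1])
  moreover have "\<exists>C>0. q < 2 \<longrightarrow> ?P C (1 / q)"
  proof (cases "q < 2")
    case True
    \<comment> \<open>Here \<open>p \<le> q < 2\<close>, so the inequality is already strict for
      \<beta> = 0.\<close>
    then have "q < 2 * (q / p + 0)" using assms pos by (simp add: field_simps)
    then show ?thesis
      using sparse_op_norm_small_p[OF params order_refl] by auto
  qed (auto intro: exI[of _ 1])
  ultimately obtain C\<^sub>1 C\<^sub>2 C\<^sub>3 where C: "0 < C\<^sub>1" "0 < C\<^sub>2" "0 < C\<^sub>3"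
    and bounds: "p \<le> 2 \<longrightarrow> ?P C\<^sub>1 (conj_exp p / q * (1 - \<alpha> / real CARD('d)))"
      "2 < p \<longrightarrow> ?P C\<^sub>2 (1 / 2 - \<alpha> / real CARD('d))" "q < 2 \<longrightarrow> ?P C\<^sub>3 (1 / q)"
    by (elim exE conjE) (rule that; assumption)
  let ?C = "C\<^sub>1 + C\<^sub>2 + C\<^sub>3"
  have "p \<le> 2 \<longrightarrow> ?P ?C (conj_exp p / q * (1 - \<alpha> / real CARD('d)))"
    using mono[OF bounds(1)[THEN mp], of ?C] C by auto
  moreover have "2 < p \<longrightarrow> ?P ?C (1 / 2 - \<alpha> / real CARD('d))"
    using mono[OF bounds(2)[THEN mp], of ?C] C by auto
  moreover have "q < 2 \<longrightarrow> ?P ?C (1 / q)"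
    using mono[OF bounds(3)[THEN mp], of ?C] C by auto
  ultimately show ?thesis
    using C unfolding not_le[symmetric] threshold by (intro exI[of _ ?C]) auto
qed

end
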